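(* There exist constants $C_4(\ell)>0$ and $C_5(\ell)>0$ for each integer $\ell\ge1$ (depending only on $\ell$), and an absolute constant $C_7>0$, such that, with $C_6:=32\pi e$, the following holds. Let $\mathcal{X}=\{x_1,\dots,x_s\}\subset(-\pi,\pi]$ form a $(\Delta,\theta,s,\ell,\tau)_{\mathbb{T}}$-clustered configuration, and let $N$ satisfy $$\frac{C_4(\ell)\,s}{\theta}\ \le\ N\ \le\ \frac{C_5(\ell)}{s\tau\Delta}.$$ Let $\mathcal{X}=\biguplus_{j=1}^M\mathcal{C}^{(j)}$ be the partition into clusters described in the context, let $\ell^{(j)}$ be the number of nodes of $\mathcal{C}^{(j)}$, and for $m=1,\dots,\ell$ let $q_m:=\#\{1\le j\le M:\ m\le\ell^{(j)}\}$ be the number of clusters of multiplicity at least $m$. Then for each $m=1,2,\dots,\ell$ there are precisely $q_m$ singular values of $\mathbf{V}_N(\mathcal{X})$ bounded from below by $$C_7\,\sqrt{N}\,\Bigl(\frac{N\Delta}{C_6}\Bigr)^{m-1}.$$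
   Context: For an ordered set of $s$ distinct nodes $\mathcal{X}=\{x_1,\dots,x_s\}\subset(-\pi,\pi]$ and an integer $N\ge s-1$, $\mathbf{V}_N(\mathcal{X})$ is the $(N+1)\times s$ Vandermonde matrix $\mathbf{V}_N(\mathcal{X})=\bigl[e^{\imath k x_j}\bigr]_{0\le k\le N}^{1\le j\le s}$ (rows indexed by $k$, columns by $j$). Wrap-around distance: for $x,y\in\mathbb{R}$, $d(x,y):=\bigl|\operatorname{Arg}\exp(\imath(x-y))\bigr|\in[0,\pi]$, where $\operatorname{Arg}$ is the principal argument with values in $(-\pi,\pi]$. Single cluster: a set of $p$ distinct nodes in $(-\pi,\pi]$ forms a $(\Delta,p,\tau)_{\mathbb{T}}$-cluster, where $\Delta>0$ and $p-1\le\tau\le\frac{\pi}{\Delta}$, if $\Delta\le d(x,y)\le\tau\Delta$ for all distinct $x,y$ in the set. Multi-cluster configuration: a set $\mathcal{X}=\{x_1,\dots,x_s\}\subset(-\pi,\pi]$ of $s$ distinct nodes forms a $(\Delta,\theta,s,\ell,\tau)_{\mathbb{T}}$-clustered configuration, for some $\Delta>0$, integers $1\le\ell\le s$, $\ell-1\le\tau\le\frac{\pi}{\Delta}$ and $\theta>0$, if for each $x_j$ there exist at most $\ell$ distinct nodes $\mathcal{X}^{(j)}=\{x_{j,k}\}_{k=1,\dots,r_j}\subset\mathcal{X}$, $1\le r_j\le\ell$, $x_{j,1}=x_j$, such that: (1) for any $y\in\mathcal{X}^{(j)}\setminus\{x_j\}$, $\Delta\le d(y,x_j)\le\tau\Delta$;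 (2) for any $y\in\mathcal{X}\setminus\mathcal{X}^{(j)}$, $d(y,x_j)\ge\theta$. Partition into clusters: in the setting of the claim, $\mathcal{X}$ admits a partition $\mathcal{X}=\biguplus_{j=1}^M\mathcal{C}^{(j)}$ such that for each $j$: $\mathcal{C}^{(j)}$ forms a $(\Delta,\ell^{(j)},\tau)_{\mathbb{T}}$-cluster with $\ell^{(j)}\le\ell$, and $d(x,y)\ge\theta$ for all $x\in\mathcal{C}^{(j)}$ and $y\in\mathcal{X}\setminus\mathcal{C}^{(j)}$. This is the partition used in the definition of $q_m$. *)

theory Defs
  imports
    Complex_Main
    "HOL-Library.Multiset"
    "HOL-Library.Disjoint_Sets"
    "HOL-Computational_Algebra.Polynomial"
    "Jordan_Normal_Form.Matrix"
    "Jordan_Normal_Form.Char_Poly"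
    "Jordan_Normal_Form.Schur_Decomposition"
begin

text \<open>Nodes are given as a list; the paper's node $x_j$ is \<open>xs ! (j - 1)\<close>.\<close>

definition vandermonde :: "nat \<Rightarrow> real list \<Rightarrow> complex mat" where
  "vandermonde N xs =
     mat (N + 1) (length xs) (\<lambda>(k, j). exp (\<i> * of_nat k * complex_of_real (xs ! j)))"

text \<open>
  The singular values of an $m \times n$ matrix, with multiplicity: the square roots of the
  eigenvalues of the smaller of the two Gram matrices $A^* A$ and $A A^*$, so that there are
  exactly $\min(m,n)$ of them. These eigenvalues are real and nonnegative, so taking the real
  part only changes the type.
\<close>

definition singular_values :: "complex mat \<Rightarrow> real multiset" where
  "singular_values A =
     image_mset (\<lambda>e. sqrt (Re e))
       (proots (char_poly
         (if dim_col A \<le> dim_row A then mat_adjoint A * A else A * mat_adjoint A)))"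

definition wrap_dist :: "real \<Rightarrow> real \<Rightarrow> real" where
  "wrap_dist x y = \<bar>Arg (exp (\<i> * complex_of_real (x - y)))\<bar>"

definition single_cluster :: "real \<Rightarrow> nat \<Rightarrow> real \<Rightarrow> real set \<Rightarrow> bool" where
  "single_cluster \<Delta> p \<tau> C \<longleftrightarrow>
     finite C \<and> card C = p \<and> C \<subseteq> {-pi<..pi} \<and>
     \<Delta> > 0 \<and> real p - 1 \<le> \<tau> \<and> \<tau> \<le> pi / \<Delta> \<and>
     (\<forall>x\<in>C. \<forall>y\<in>C. x \<noteq> y \<longrightarrow> \<Delta> \<le> wrap_dist x y \<and> wrap_dist x y \<le> \<tau> * \<Delta>)"

definition clustered_configuration ::
  "real \<Rightarrow> real \<Rightarrow> nat \<Rightarrow> nat \<Rightarrow> real \<Rightarrow> real set \<Rightarrow> bool" where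
  "clustered_configuration \<Delta> \<theta> s l \<tau> X \<longleftrightarrow>
     finite X \<and> card X = s \<and> X \<subseteq> {-pi<..pi} \<and>
     \<Delta> > 0 \<and> 1 \<le> l \<and> l \<le> s \<and> real l - 1 \<le> \<tau> \<and> \<tau> \<le> pi / \<Delta> \<and> \<theta> > 0 \<and>
     (\<forall>x\<in>X. \<exists>Y\<subseteq>X. x \<in> Y \<and> card Y \<le> l \<and>
        (\<forall>y\<in>Y - {x}. \<Delta> \<le> wrap_dist y x \<and> wrap_dist y x \<le> \<tau> * \<Delta>) \<and>
        (\<forall>y\<in>X - Y. wrap_dist y x \<ge> \<theta>))"

definition cluster_partition ::
  "real \<Rightarrow> real \<Rightarrow> nat \<Rightarrow> real \<Rightarrow> real set \<Rightarrow> real set set \<Rightarrow> bool" where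
  "cluster_partition \<Delta> \<theta> l \<tau> X P \<longleftrightarrow>
     partition_on X P \<and>
     (\<forall>C\<in>P. single_cluster \<Delta> (card C) \<tau> C \<and> card C \<le> l \<and>
        (\<forall>x\<in>C. \<forall>y\<in>X - C. wrap_dist x y \<ge> \<theta>))"

definition num_clusters :: "real set set \<Rightarrow> nat \<Rightarrow> nat" where
  "num_clusters P m = card {C \<in> P. m \<le> card C}"

text \<open>
  That, for each $m = 1, \dots, \ell$, precisely $q_m$ singular values are bounded from below by
  $b_m$ means that the singular values, with multiplicity, split into $\ell$ groups \<open>S m\<close>, the
  \<open>m\<close>-th one consisting of $q_m$ values that are all at least $b_m$. It does not mean that $q_m$
  is the total number of singular values above $b_m$: the thresholds of interest decrease
  with \<open>m\<close>, so the members of group 1 exceed $b_2$ as well, whereas $q_2 \le q_1$.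
\<close>

definition grouped_lower_bounds ::
  "nat \<Rightarrow> (nat \<Rightarrow> nat) \<Rightarrow> (nat \<Rightarrow> real) \<Rightarrow> real multiset \<Rightarrow> bool" where
  "grouped_lower_bounds l q b sv \<longleftrightarrow>
     (\<exists>S :: nat \<Rightarrow> real multiset.
        sv = (\<Sum>m=1..l. S m) \<and>
        (\<forall>m\<in>{1..l}. size (S m) = q m \<and> (\<forall>\<sigma>\<in>#S m. b m \<le> \<sigma>)))"

text \<open>
  The range $C_4 s / \theta \le N \le C_5 / (s \tau \Delta)$. The upper bound is stated without
  the division because $\tau = 0$ is admissible when $\ell = 1$; it is then no constraint.
\<close>

definition admissible_N ::
  "real \<Rightarrow> real \<Rightarrow> real \<Rightarrow> real \<Rightarrow> nat \<Rightarrow> real \<Rightarrow> nat \<Rightarrow> bool" where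
  "admissible_N C\<^sub>4 C\<^sub>5 \<Delta> \<theta> s \<tau> N \<longleftrightarrow>
     C\<^sub>4 * real s / \<theta> \<le> real N \<and> real N * (real s * \<tau> * \<Delta>) \<le> C\<^sub>5"

end

theory Submission
  imports Defs "HOL-Analysis.Convex"
begin

text \<open>
  A vector of coefficients on the nodes is turned by the Vandermonde matrix into the values
  \<open>f k = (\<Sum>x. c x * cis x ^ k)\<close>, \<open>k \<le> N\<close>, of an exponential sum. By the Courant--Fischer
  principle in the form \<open>card_le_singular_values_above\<close>, it suffices to find, for each \<open>m\<close>, a
  coordinate subspace of dimension \<open>q 1 + \<dots> + q m\<close> on which the matrix expands norms by at
  least the \<open>m\<close>-th threshold. Keep \<open>min m (card C)\<close> arbitrary nodes of each cluster \<open>C\<close>: by double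
  counting these are \<open>q 1 + \<dots> + q m\<close> nodes, and now every cluster has at most \<open>m\<close> of them. So
  everything reduces to a lower bound for the smallest singular value of clusters of size at
  most \<open>m\<close>.

  All analytic estimates rest on one device. If \<open>Q\<close> is a polynomial, then
  \<open>\<Sum>j. coeff Q j * f (k + j * h)\<close> is again an exponential sum with the same frequencies, in which
  the coefficient at \<open>w\<close> has been multiplied by \<open>poly Q (w ^ h)\<close>. If \<open>Q\<close> is monic with roots on
  the unit circle, the coefficients of \<open>Q\<close> have absolute sum at most \<open>2 ^ degree Q\<close>, so this operation
  is cheap; the step \<open>h\<close> can be as large as \<open>N\<close> divided by the number of frequencies.

  \<^item> \<open>Q\<close> with all frequencies but one as roots isolates a single coefficient. The factor
    \<open>poly Q (w ^ h)\<close> is a product of chord lengths of the nodes magnified by \<open>h\<close>. On an interval, a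
    node of \<open>q + 1\<close> nodes with gaps \<open>\<Delta>\<close> has product of distances at least
    \<open>\<Delta> ^ q * fact q / 2 ^ q\<close>, and \<open>fact q \<ge> (q / exp 1) ^ q\<close> cancels the \<open>q ^ q\<close>
    lost in the choice \<open>h \<approx> N / q\<close>. This is \<open>single_cluster_lower_bound\<close>, where the constant
    \<open>32 * pi * exp 1\<close> appears.

  \<^item> \<open>Q\<close> with all frequencies as roots expresses any value of \<open>f\<close> through other values
    of \<open>f\<close>. Averaging over \<open>h\<close> gives a bound of each value by the quadratic mean
    (\<open>norm_le_l2_norm\<close>). Summing over \<open>k\<close> instead shows that an exponential sum whose frequencies
    all stay away from \<open>1\<close> has a small sum (\<open>sum_exponential_sum_bound\<close>). Applied to \<open>f * cnj g\<close> for
    two clusters at distance \<open>\<theta>\<close>, both together show that the column spaces of the clusters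
    are orthogonal up to \<open>O(1 / (N * \<theta>))\<close>, hence up to \<open>1 / (2 * s)\<close> if \<open>N\<close> is at least a
    large multiple of \<open>s / \<theta>\<close>.

  Since there are at most \<open>s\<close> clusters, this almost orthogonality makes the squared norm of the sum at
  least half the sum of the squared norms over the clusters, and the single-cluster bounds add up.
\<close>

section \<open>Filtering exponential sums by polynomials\<close>

definition annihilator :: "('a \<Rightarrow> complex) \<Rightarrow> nat \<Rightarrow> 'a set \<Rightarrow> complex poly" where
  "annihilator w t A = (\<Prod>a\<in>A. [:- (w a ^ t), 1:])"

lemma degree_annihilator: "finite A \<Longrightarrow> degree (annihilator w t A) = card A"
  unfolding annihilator_def by (subst degree_prod_eq_sum_degree) auto

lemma poly_annihilator: "poly (annihilator w t A) z = (\<Prod>a\<in>A. z - w a ^ t)"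
  unfolding annihilator_def by (simp add: poly_prod)

lemma coeff_annihilator_0:
  assumes "finite A" "\<And>a. a \<in> A \<Longrightarrow> norm (w a) = 1"
  shows "norm (coeff (annihilator w t A) 0) = 1"
proof -
  have "coeff (annihilator w t A) 0 = (\<Prod>a\<in>A. - (w a ^ t))"
    by (simp add: poly_0_coeff_0[symmetric] poly_annihilator)
  thus ?thesis using assms by (simp add: prod_norm[symmetric] norm_power)
qed

text \<open>
  The absolute sum of coefficients is submultiplicative, and each of the linear factors
  contributes a factor \<open>2\<close>.
\<close>
lemma sum_norm_coeff_annihilator:
  assumes "finite A" "\<And>a. a \<in> A \<Longrightarrow> norm (w a) = 1"
  shows "(\<Sum>j\<le>card A. norm (coeff (annihilator w t A) j)) \<le> 2 ^ card A"
  using assms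
proof (induction A)
  case empty
  show ?case by (simp add: annihilator_def)
next
  case (insert a A)
  let ?Q = "annihilator w t A"
  let ?n = "card A"
  have Q: "annihilator w t (insert a A) = [:- (w a ^ t), 1:] * ?Q"
    using insert by (simp add: annihilator_def)
  have c: "coeff (annihilator w t (insert a A)) j
      = - (w a ^ t) * coeff ?Q j + (case j of 0 \<Rightarrow> 0 | Suc i \<Rightarrow> coeff ?Q i)" for j
    unfolding Q by (simp add: coeff_pCons split: nat.splits)
  have top: "coeff ?Q (Suc ?n) = 0"
    using insert degree_annihilator[of A w t] by (intro coeff_eq_0) auto
  have "norm (coeff (annihilator w t (insert a A)) j)
      \<le> norm (coeff ?Q j) + (case j of 0 \<Rightarrow> 0 | Suc i \<Rightarrow> norm (coeff ?Q i))" for j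
  proof -
    have "norm (- (w a ^ t) * coeff ?Q j) = norm (coeff ?Q j)"
      using insert by (simp add: norm_mult norm_power)
    thus ?thesis unfolding c
      by (cases j) (simp_all del: mult_minus_left add: norm_triangle_le)
  qed
  hence "(\<Sum>j\<le>Suc ?n. norm (coeff (annihilator w t (insert a A)) j))
      \<le> (\<Sum>j\<le>Suc ?n. norm (coeff ?Q j) + (case j of 0 \<Rightarrow> 0 | Suc i \<Rightarrow> norm (coeff ?Q i)))"
    by (intro sum_mono)
  also have "\<dots> = (\<Sum>j\<le>?n. norm (coeff ?Q j)) + (\<Sum>j\<le>?n. norm (coeff ?Q j))"
    unfolding sum.distrib
    by (subst (2) sum.atMost_Suc_shift) (simp add: top)
  also have "\<dots> \<le> 2 ^ ?n + 2 ^ ?n" using insert by (intro add_mono) auto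
  finally show ?case using insert by simp
qed

text \<open>
  Replacing \<open>X ^ j\<close> by a shift by \<open>j * t\<close> lets a polynomial act on sequences; the geometric
  sequence \<open>w ^ k\<close> is an eigenvector with eigenvalue \<open>poly Q (w ^ t)\<close>.
\<close>
lemma poly_filter_exponential_sum:
  fixes c w :: "'a \<Rightarrow> complex"
  assumes "finite A" "degree Q \<le> r"
  shows "(\<Sum>j\<le>r. coeff Q j * (\<Sum>a\<in>A. c a * w a ^ (k + j * t)))
       = (\<Sum>a\<in>A. c a * w a ^ k * poly Q (w a ^ t))"
proof -
  have p: "poly Q z = (\<Sum>j\<le>r. coeff Q j * z ^ j)" for z
    unfolding poly_altdef by (rule sum.mono_neutral_left) (use assms(2) in \<open>auto simp: coeff_eq_0\<close>)
  show ?thesis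
    unfolding p sum_distrib_left
    by (subst sum.swap) (simp add: power_add mult_ac flip: power_mult)
qed

lemma annihilator_kills:
  assumes "finite A"
  shows "(\<Sum>j\<le>card A. coeff (annihilator w t A) j * (\<Sum>a\<in>A. c a * w a ^ (k + j * t))) = 0"
  using poly_filter_exponential_sum[OF assms, of "annihilator w t A" "card A"]
    degree_annihilator[OF assms, of w t] assms
  by (auto simp: poly_annihilator prod_zero_iff intro!: sum.neutral)

section \<open>Pointwise bounds and cancellation for exponential sums\<close>

text \<open>
  The annihilator for step \<open>h\<close> has a constant coefficient of modulus \<open>1\<close>, so \<open>f n\<close> is a
  combination of \<open>f (n + h), \<dots>, f (n + p * h)\<close> with coefficients of absolute sum at most \<open>2 ^ p\<close>.
  As \<open>h\<close> varies, each of these positions runs through distinct indices, so that averaging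
  over the \<open>N div (2 * p)\<close> admissible values of \<open>h\<close> produces the quadratic mean. The first half
  of the range is the one in which there is room to the right of \<open>n\<close>.
\<close>

lemma norm_le_l2_norm_first_half:
  fixes f :: "nat \<Rightarrow> complex"
  assumes A: "finite A" "A \<noteq> {}" and w: "\<And>a. a \<in> A \<Longrightarrow> norm (w a) = 1"
    and f: "\<And>k. k \<le> N \<Longrightarrow> f k = (\<Sum>a\<in>A. c a * w a ^ k)" and n: "2 * n \<le> N"
  shows "(norm (f n))\<^sup>2 * real N \<le> 4 ^ (card A + 1) * (real (card A))\<^sup>2 * (\<Sum>k\<le>N. (norm (f k))\<^sup>2)"
proof -
  define p where "p = card A"
  define S where "S = (\<Sum>k\<le>N. (norm (f k))\<^sup>2)"
  have p: "p \<ge> 1" using A unfolding p_def by (simp add: Suc_le_eq card_gt_0_iff)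
  have S0: "S \<ge> 0" unfolding S_def by (intro sum_nonneg) auto
  have fS: "(norm (f n))\<^sup>2 \<le> S"
    unfolding S_def using n by (intro member_le_sum) auto
  define H where "H = N div (2 * p)"
  have *: "(norm (f n))\<^sup>2 \<le> 4 ^ p * (\<Sum>j\<in>{1..p}. (norm (f (n + j * h)))\<^sup>2)"
    if h: "h \<in> {1..H}" for h
  proof -
    define Q where "Q = annihilator w h A"
    define T where "T = (\<Sum>j\<in>{1..p}. (norm (f (n + j * h)))\<^sup>2)"
    have T0: "T \<ge> 0" unfolding T_def by (intro sum_nonneg) auto
    have le: "n + j * h \<le> N" if "j \<le> p" for j
    proof -
      have "2 * (j * h) \<le> 2 * (p * H)" using that h by (intro mult_left_mono mult_mono) auto
      also have "\<dots> = (N div (2 * p)) * (2 * p)" unfolding H_def by (simp add: mult_ac)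
      also have "\<dots> \<le> N" by simp
      finally show ?thesis using n by simp
    qed
    have "0 = (\<Sum>j\<le>p. coeff Q j * (\<Sum>a\<in>A. c a * w a ^ (n + j * h)))"
      unfolding p_def Q_def using annihilator_kills[OF A(1)] by simp
    also have "\<dots> = (\<Sum>j\<le>p. coeff Q j * f (n + j * h))"
      using le by (intro sum.cong refl) (simp add: f)
    also have "\<dots> = coeff Q 0 * f n + (\<Sum>j\<in>{1..p}. coeff Q j * f (n + j * h))"
    proof -
      have "{..p} = insert 0 {1..p}" by auto
      thus ?thesis by simp
    qed
    finally have "coeff Q 0 * f n = - (\<Sum>j\<in>{1..p}. coeff Q j * f (n + j * h))"
      by (simp add: eq_neg_iff_add_eq_0)
    hence "norm (coeff Q 0 * f n) = norm (\<Sum>j\<in>{1..p}. coeff Q j * f (n + j * h))"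
      by (simp only: norm_minus_cancel)
    hence "norm (f n) = norm (\<Sum>j\<in>{1..p}. coeff Q j * f (n + j * h))"
      using coeff_annihilator_0[OF A(1) w, where t = h] by (simp add: norm_mult Q_def)
    also have "\<dots> \<le> (\<Sum>j\<in>{1..p}. norm (coeff Q j) * sqrt T)"
    proof (rule sum_norm_le)
      fix j assume "j \<in> {1..p}"
      hence "(norm (f (n + j * h)))\<^sup>2 \<le> T" unfolding T_def by (intro member_le_sum) auto
      hence "norm (f (n + j * h)) \<le> sqrt T" by (rule real_le_rsqrt)
      thus "norm (coeff Q j * f (n + j * h)) \<le> norm (coeff Q j) * sqrt T"
        by (simp add: norm_mult mult_left_mono)
    qed
    also have "\<dots> = (\<Sum>j\<in>{1..p}. norm (coeff Q j)) * sqrt T" by (simp add: sum_distrib_right)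
    also have "\<dots> \<le> (\<Sum>j\<le>p. norm (coeff Q j)) * sqrt T"
      using T0 by (intro mult_right_mono sum_mono2) auto
    also have "\<dots> \<le> 2 ^ p * sqrt T"
      unfolding p_def Q_def using T0
      by (intro mult_right_mono sum_norm_coeff_annihilator A w) auto
    finally have "(norm (f n))\<^sup>2 \<le> (2 ^ p * sqrt T)\<^sup>2" by (rule power_mono) auto
    also have "\<dots> = (2 ^ p)\<^sup>2 * T" using T0 by (simp add: power_mult_distrib)
    also have "(2 ^ p)\<^sup>2 = (4 ^ p :: real)" by (simp add: power2_eq_square flip: power_mult_distrib)
    finally show ?thesis unfolding T_def .
  qed
  have inner: "(\<Sum>h\<in>{1..H}. (norm (f (n + j * h)))\<^sup>2) \<le> S" if j: "j \<in> {1..p}" for j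
  proof -
    have inj: "inj_on (\<lambda>h. n + j * h) {1..H}" using j by (auto simp: inj_on_def)
    have "(\<Sum>h\<in>{1..H}. (norm (f (n + j * h)))\<^sup>2) = (\<Sum>k\<in>(\<lambda>h. n + j * h) ` {1..H}. (norm (f k))\<^sup>2)"
      by (subst sum.reindex[OF inj]) simp
    also have "\<dots> \<le> S" unfolding S_def
    proof (intro sum_mono2)
      show "(\<lambda>h. n + j * h) ` {1..H} \<subseteq> {..N}"
      proof clarsimp
        fix h assume h: "Suc 0 \<le> h" "h \<le> H"
        have "2 * (j * h) \<le> 2 * (p * H)" using j h by (intro mult_left_mono mult_mono) auto
        also have "\<dots> = (N div (2 * p)) * (2 * p)" unfolding H_def by (simp add: mult_ac)
        also have "\<dots> \<le> N" by simp
        finally show "n + j * h \<le> N" using n by simp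
      qed
    qed auto
    finally show ?thesis .
  qed
  have "real H * (norm (f n))\<^sup>2 = (\<Sum>h\<in>{1..H}. (norm (f n))\<^sup>2)" by simp
  also have "\<dots> \<le> (\<Sum>h\<in>{1..H}. 4 ^ p * (\<Sum>j\<in>{1..p}. (norm (f (n + j * h)))\<^sup>2))"
    by (intro sum_mono *) auto
  also have "\<dots> = 4 ^ p * (\<Sum>j\<in>{1..p}. \<Sum>h\<in>{1..H}. (norm (f (n + j * h)))\<^sup>2)"
    unfolding sum_distrib_left[symmetric] by (subst sum.swap) simp
  also have "\<dots> \<le> 4 ^ p * (\<Sum>j\<in>{1..p}. S)"
    by (intro mult_left_mono sum_mono inner) auto
  finally have main: "real H * (norm (f n))\<^sup>2 \<le> 4 ^ p * real p * S" by simp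
  have "(norm (f n))\<^sup>2 * real N \<le> 4 ^ (p + 1) * (real p)\<^sup>2 * S"
  proof (cases "N < 2 * p")
    (* For N < 2 * p no step is admissible, but the constant is then so large
       that the trivial bound by the full sum suffices. *)
    case True
    have "(norm (f n))\<^sup>2 * real N \<le> S * real (2 * p)" using True fS S0 by (intro mult_mono) auto
    also have "\<dots> \<le> S * (4 ^ (p + 1) * (real p)\<^sup>2)"
    proof (intro mult_left_mono S0)
      have "(2::real) * (real p * 1) \<le> 4 ^ (p + 1) * (real p * real p)"
      proof (intro mult_mono)
        have "(1::real) \<le> 4 ^ p" by (rule one_le_power) simp
        hence "(2::real) \<le> 4 * 4 ^ p" by linarith
        thus "(2::real) \<le> 4 ^ (p + 1)" by simp
      qed (use p in auto)
      thus "real (2 * p) \<le> 4 ^ (p + 1) * (real p)\<^sup>2" by (simp add: power2_eq_square)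
    qed
    finally show ?thesis by (simp add: mult_ac)
  next
    case False
    hence "1 \<le> H" unfolding H_def using p by (simp add: Suc_le_eq div_greater_zero_iff)
    hence "1 * (2 * p) \<le> H * (2 * p)" by (rule mult_right_mono) simp
    moreover have "N = H * (2 * p) + N mod (2 * p)" unfolding H_def by (rule div_mult_mod_eq[symmetric])
    moreover have "N mod (2 * p) < 2 * p" using p by (intro mod_less_divisor) simp
    ultimately have "N \<le> 2 * (H * (2 * p))" by linarith
    hence "real N \<le> real (2 * (H * (2 * p)))" by (rule of_nat_mono)
    hence "real N \<le> 4 * real p * real H" by (simp add: mult_ac)
    hence "(norm (f n))\<^sup>2 * real N \<le> (norm (f n))\<^sup>2 * (4 * real p * real H)"
      by (intro mult_left_mono) auto
    also have "\<dots> = 4 * real p * (real H * (norm (f n))\<^sup>2)" by simp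
    also have "\<dots> \<le> 4 * real p * (4 ^ p * real p * S)" by (intro mult_left_mono main) auto
    finally show ?thesis by (simp add: power2_eq_square mult_ac)
  qed
  thus ?thesis unfolding p_def S_def .
qed

text \<open>
  The values in the second half are reached by reversing time: \<open>k \<mapsto> f (N - k)\<close> is an exponential
  sum with the conjugate frequencies.
\<close>
lemma norm_le_l2_norm:
  fixes f :: "nat \<Rightarrow> complex"
  assumes A: "finite A" and w: "\<And>a. a \<in> A \<Longrightarrow> norm (w a) = 1"
    and f: "\<And>k. f k = (\<Sum>a\<in>A. c a * w a ^ k)" and n: "n \<le> N"
  shows "(norm (f n))\<^sup>2 * real N \<le> 4 ^ (card A + 1) * (real (card A))\<^sup>2 * (\<Sum>k\<le>N. (norm (f k))\<^sup>2)"
proof (cases "A = {}")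
  case True
  thus ?thesis by (simp add: f)
next
  case ne: False
  show ?thesis
  proof (cases "2 * n \<le> N")
    case True
    show ?thesis by (rule norm_le_l2_norm_first_half[OF A ne w f True])
  next
    case False
    let ?g = "\<lambda>k. f (N - k)"
    have "(norm (?g (N - n)))\<^sup>2 * real N
        \<le> 4 ^ (card A + 1) * (real (card A))\<^sup>2 * (\<Sum>k\<le>N. (norm (?g k))\<^sup>2)"
    proof (rule norm_le_l2_norm_first_half[OF A ne])
      show "norm (cnj (w a)) = 1" if "a \<in> A" for a using w[OF that] by simp
      show "?g k = (\<Sum>a\<in>A. (c a * w a ^ N) * cnj (w a) ^ k)" if k: "k \<le> N" for k
        unfolding f
      proof (intro sum.cong refl)
        fix a assume "a \<in> A"
        hence 1: "w a * cnj (w a) = 1" using w by (simp add: complex_norm_square[symmetric])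
        have "w a ^ N = w a ^ (N - k) * w a ^ k" using k by (simp flip: power_add)
        hence "(c a * w a ^ N) * cnj (w a) ^ k = c a * w a ^ (N - k) * (w a ^ k * cnj (w a) ^ k)"
          by (simp only: mult_ac)
        also have "w a ^ k * cnj (w a) ^ k = 1" by (simp only: 1 power_one flip: power_mult_distrib)
        finally show "c a * w a ^ (N - k) = (c a * w a ^ N) * cnj (w a) ^ k"
          by (simp only: mult_1_right)
      qed
      show "2 * (N - n) \<le> N" using False by simp
    qed
    moreover have "(\<Sum>k\<le>N. (norm (f (N - k)))\<^sup>2) = (\<Sum>k\<le>N. (norm (f k))\<^sup>2)"
      by (rule sum.reindex_bij_witness[of _ "\<lambda>k. N - k" "\<lambda>k. N - k"]) auto
    ultimately show ?thesis using n by simp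
  qed
qed

text \<open>
  Summing the recurrence \<open>\<Sum>j. coeff Q j * h (k + j * t) = 0\<close> over \<open>k\<close> replaces every shifted sequence by
  the full sum, up to at most \<open>card A * t\<close> boundary terms. What remains is \<open>poly Q 1\<close> times the sum, and
  \<open>poly Q 1\<close> is the product of the \<open>1 - w a ^ t\<close>. It is essential for the later application that the
  frequencies are assumed to stay away from \<open>1\<close> only after taking \<open>t\<close>-th powers: a frequency at
  distance \<open>\<theta>\<close> from \<open>1\<close> then costs \<open>1 / \<theta>\<close> only to the first power, through \<open>t\<close>, however many frequencies there are.
\<close>
lemma sum_exponential_sum_bound:
  fixes h :: "nat \<Rightarrow> complex"
  assumes A: "finite A" and w: "\<And>a. a \<in> A \<Longrightarrow> norm (w a) = 1"
    and h: "\<And>k. h k = (\<Sum>a\<in>A. c a * w a ^ k)"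
    and away: "\<And>a. a \<in> A \<Longrightarrow> norm (1 - w a ^ t) \<ge> 1 / 2"
    and B: "\<And>k. k \<le> N \<Longrightarrow> norm (h k) \<le> B"
  shows "norm (\<Sum>k\<le>N. h k) \<le> 4 ^ card A * (real (card A) * real t * B)"
proof -
  define r where "r = card A"
  define S where "S = (\<Sum>k\<le>N. h k)"
  define Q where "Q = annihilator w t A"
  have B0: "B \<ge> 0" using B[of 0] norm_ge_zero[of "h 0"] by linarith
  have "norm S \<le> 4 ^ r * (real r * real t * B)"
  proof (cases "r * t \<le> N")
    case False
    have "norm S \<le> (\<Sum>k\<le>N. B)" unfolding S_def by (rule sum_norm_le) (use B in auto)
    also have "\<dots> = real (N + 1) * B" by simp
    also have "\<dots> \<le> real (r * t) * B" using False B0 by (intro mult_right_mono) (simp_all flip: of_nat_mult)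
    also have "\<dots> \<le> 4 ^ r * (real (r * t) * B)"
      using mult_right_mono[of 1 "4 ^ r" "real (r * t) * B"] B0 by simp
    finally show ?thesis by simp
  next
    case True
    define L where "L = N - r * t"
    define W where "W j = (\<Sum>k\<le>L. h (k + j * t))" for j
    have W: "norm (S - W j) \<le> real (r * t) * B" if j: "j \<le> r" for j
    proof -
      have jt: "j * t \<le> r * t" using j by simp
      let ?I = "{j * t..L + j * t}"
      have sub: "?I \<subseteq> {..N}" using add_mono[OF order.refl jt, of L] True by (auto simp: L_def)
      have "W j = (\<Sum>k\<in>?I. h k)" unfolding W_def
        by (rule sum.reindex_bij_witness[of _ "\<lambda>k. k - j * t" "\<lambda>k. k + j * t"]) auto
      hence "S - W j = (\<Sum>k\<in>{..N} - ?I. h k)" unfolding S_def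
        by (subst sum_diff[OF _ sub]) auto
      also have "norm \<dots> \<le> (\<Sum>k\<in>{..N} - ?I. B)" by (rule sum_norm_le) (use B in auto)
      also have "\<dots> = real (card ({..N} - ?I)) * B" by simp
      also have "card ({..N} - ?I) = r * t"
        using True sub by (subst card_Diff_subset) (auto simp: L_def)
      finally show ?thesis .
    qed
    have "(\<Sum>j\<le>r. coeff Q j * W j) = (\<Sum>k\<le>L. \<Sum>j\<le>r. coeff Q j * h (k + j * t))"
      unfolding W_def sum_distrib_left by (rule sum.swap)
    also have "\<dots> = 0"
      unfolding h r_def Q_def using annihilator_kills[OF A] by (intro sum.neutral) auto
    finally have z: "(\<Sum>j\<le>r. coeff Q j * W j) = 0" .
    have "poly Q 1 * S = (\<Sum>j\<le>r. coeff Q j) * S"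
      using degree_annihilator[OF A, of w t] by (simp add: poly_altdef Q_def r_def)
    also have "\<dots> = (\<Sum>j\<le>r. coeff Q j * (S - W j))"
      using z by (simp add: sum_distrib_right right_diff_distrib sum_subtractf)
    finally have "norm (poly Q 1) * norm S = norm (\<Sum>j\<le>r. coeff Q j * (S - W j))"
      by (simp flip: norm_mult)
    also have "\<dots> \<le> (\<Sum>j\<le>r. norm (coeff Q j) * (real (r * t) * B))"
      by (rule sum_norm_le) (simp add: norm_mult mult_left_mono W del: of_nat_mult)
    also have "\<dots> = (\<Sum>j\<le>r. norm (coeff Q j)) * (real (r * t) * B)"
      by (simp add: sum_distrib_right)
    also have "\<dots> \<le> 2 ^ r * (real (r * t) * B)"
      unfolding r_def Q_def using B0 by (intro mult_right_mono sum_norm_coeff_annihilator A w) auto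
    finally have 1: "norm (poly Q 1) * norm S \<le> 2 ^ r * (real (r * t) * B)" .
    have "(1 / 2) ^ r = (\<Prod>a\<in>A. 1 / 2 :: real)" by (simp add: r_def)
    also have "\<dots> \<le> (\<Prod>a\<in>A. norm (1 - w a ^ t))" by (intro prod_mono) (use away in auto)
    also have "\<dots> = norm (poly Q 1)" by (simp add: Q_def poly_annihilator prod_norm)
    finally have "(1 / 2) ^ r * norm S \<le> norm (poly Q 1) * norm S" by (intro mult_right_mono) auto
    with 1 have "(1 / 2) ^ r * norm S \<le> 2 ^ r * (real (r * t) * B)" by linarith
    hence "2 ^ r * ((1 / 2) ^ r * norm S) \<le> 2 ^ r * (2 ^ r * (real (r * t) * B))"
      by (intro mult_left_mono) auto
    moreover have "2 ^ r * ((1 / 2) ^ r * norm S) = norm S" by (simp add: power_one_over)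
    moreover have "2 ^ r * 2 ^ r = (4 ^ r :: real)" by (simp flip: power_mult_distrib)
    ultimately show ?thesis by (simp only: of_nat_mult flip: mult.assoc)
  qed
  thus ?thesis unfolding r_def S_def .
qed

section \<open>Chords and the wrap-around distance\<close>

lemma norm_cis_diff: "norm (cis x - cis y) = 2 * \<bar>sin ((x - y) / 2)\<bar>"
proof -
  have "(norm (cis x - cis y))\<^sup>2 = (cos x - cos y)\<^sup>2 + (sin x - sin y)\<^sup>2"
    by (simp add: cmod_power2)
  also have "\<dots> = (sin x)\<^sup>2 + (cos x)\<^sup>2 + ((sin y)\<^sup>2 + (cos y)\<^sup>2) - 2 * (cos x * cos y + sin x * sin y)"
    by (simp add: power2_diff del: sin_cos_squared_add sin_cos_squared_add2)
  also have "\<dots> = 2 - 2 * cos (x - y)" by (simp add: cos_diff)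
  also have "\<dots> = (2 * \<bar>sin ((x - y) / 2)\<bar>)\<^sup>2"
  proof -
    define z where "z = (x - y) / 2"
    have "x - y = 2 * z" by (simp add: z_def)
    thus ?thesis unfolding z_def[symmetric] by (simp add: cos_double_sin power_mult_distrib)
  qed
  finally show ?thesis by (rule power2_eq_imp_eq) auto
qed

lemma norm_cis_diff_le: "norm (cis x - cis y) \<le> \<bar>x - y\<bar>"
  using abs_sin_x_le_abs_x[of "(x - y) / 2"] by (simp add: norm_cis_diff)

lemma norm_cis_diff_ge:
  assumes "\<bar>x - y\<bar> \<le> 1"
  shows "\<bar>x - y\<bar> / 2 \<le> norm (cis x - cis y)"
proof -
  define v where "v = \<bar>x - y\<bar> / 2"
  have v: "0 \<le> v" "v \<le> 1 / 2" using assms by (auto simp: v_def)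
  have "\<bar>sin v - v\<bar> \<le> v ^ 3 / 6"
    using Maclaurin_sin_bound[of v 3] v by (simp add: sin_coeff_def eval_nat_numeral)
  moreover have "v ^ 3 \<le> v * 1"
    unfolding power3_eq_cube mult.assoc using v by (intro mult_left_mono mult_le_one) auto
  ultimately have "v / 2 \<le> sin v" using v by linarith
  moreover have "v = (x - y) / 2 \<or> v = - ((x - y) / 2)" unfolding v_def by linarith
  hence "\<bar>sin ((x - y) / 2)\<bar> = \<bar>sin v\<bar>" by (metis abs_minus_cancel sin_minus)
  ultimately show ?thesis unfolding norm_cis_diff by (simp add: v_def)
qed

lemma wrap_dist_lift:
  obtains a where "\<bar>a\<bar> = wrap_dist x y" "\<bar>a\<bar> \<le> pi" "cis a = cis (x - y)"
proof (rule that)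
  let ?a = "Arg (exp (\<i> * complex_of_real (x - y)))"
  show "\<bar>?a\<bar> = wrap_dist x y" by (simp add: wrap_dist_def)
  show "\<bar>?a\<bar> \<le> pi" using Arg_bounded[of "exp (\<i> * complex_of_real (x - y))"] by linarith
  show "cis ?a = cis (x - y)" 
    unfolding cis_conv_exp[symmetric] by (simp add: cis_Arg sgn_div_norm)
qed

lemma wrap_dist_le_pi: "wrap_dist x y \<le> pi"
  by (rule wrap_dist_lift[of x y]) simp

lemma wrap_dist_self [simp]: "wrap_dist x x = 0"
  using cis_Arg_unique[of 1 0] by (simp add: wrap_dist_def)

lemma norm_cis_minus_one_eq: "norm (cis u - 1) = norm (cis x - cis y)" if "cis u = cis (x - y)"
proof -
  have "cis x - cis y = (cis u - 1) * cis y" unfolding that by (simp add: left_diff_distrib cis_mult)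
  thus ?thesis by (simp add: norm_mult)
qed

lemma norm_cis_diff_le_wrap_dist: "norm (cis x - cis y) \<le> wrap_dist x y"
proof -
  obtain a where "\<bar>a\<bar> = wrap_dist x y" "cis a = cis (x - y)" by (rule wrap_dist_lift)
  thus ?thesis using norm_cis_minus_one_eq[of a x y] norm_cis_diff_le[of a 0] by simp
qed

text \<open>
  Equal chords belong to arcs of equal length as long as these are at most \<open>pi\<close>, and longer
  lifts are not shorter than the wrap-around distance either.
\<close>
lemma wrap_dist_le_lift:
  assumes "cis u = cis (x - y)"
  shows "wrap_dist x y \<le> \<bar>u\<bar>"
proof (rule ccontr)
  obtain a where a: "\<bar>a\<bar> = wrap_dist x y" "\<bar>a\<bar> \<le> pi" "cis a = cis (x - y)" by (rule wrap_dist_lift)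
  assume "\<not> wrap_dist x y \<le> \<bar>u\<bar>"
  hence less: "\<bar>u\<bar> < \<bar>a\<bar>" using a by simp
  have sin: "\<bar>sin (v / 2)\<bar> = sin (\<bar>v\<bar> / 2)" if "\<bar>v\<bar> \<le> pi" for v
    using that sin_ge_zero[of "\<bar>v\<bar> / 2"] by (cases "v \<ge> 0") auto
  have "sin (\<bar>u\<bar> / 2) < sin (\<bar>a\<bar> / 2)"
    using less a by (intro sin_monotone_2pi) auto
  hence "norm (cis u - cis 0) < norm (cis a - cis 0)"
    unfolding norm_cis_diff using sin[of u] sin[of a] less a by simp
  thus False using assms a by simp
qed

text \<open>
  Measuring all angles from one node of the cluster places the cluster on the real line, where the
  nodes are ordered. Distances on the line are never smaller than distances on the circle.
\<close>
lemma lift_cluster: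
  assumes "\<And>x y. x \<in> A \<Longrightarrow> y \<in> A \<Longrightarrow> x \<noteq> y \<Longrightarrow> \<Delta> \<le> wrap_dist x y"
    and "\<And>x y. x \<in> A \<Longrightarrow> y \<in> A \<Longrightarrow> wrap_dist x y \<le> \<eta>"
  obtains Y :: "real \<Rightarrow> real" where "\<And>x. cis (Y x) = cis x"
    "\<And>x y. x \<in> A \<Longrightarrow> y \<in> A \<Longrightarrow> x \<noteq> y \<Longrightarrow> \<Delta> \<le> \<bar>Y x - Y y\<bar>"
    "\<And>x y. x \<in> A \<Longrightarrow> y \<in> A \<Longrightarrow> \<bar>Y x - Y y\<bar> \<le> 2 * \<eta>"
proof -
  obtain x0 where x0: "A \<noteq> {} \<Longrightarrow> x0 \<in> A" by blast
  have "\<forall>x. \<exists>a. \<bar>a\<bar> = wrap_dist x x0 \<and> cis a = cis (x - x0)" by (metis wrap_dist_lift)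
  then obtain a where a: "\<And>x. \<bar>a x\<bar> = wrap_dist x x0" "\<And>x. cis (a x) = cis (x - x0)" by metis
  show ?thesis
  proof (rule that[of "\<lambda>x. x0 + a x"])
    show c: "cis (x0 + a x) = cis x" for x by (simp add: a cis_mult flip: cis_mult[of x0 "a x"])
    fix x y assume xy: "x \<in> A" "y \<in> A"
    show "\<bar>(x0 + a x) - (x0 + a y)\<bar> \<le> 2 * \<eta>"
    proof -
      have "x0 \<in> A" using x0 xy by blast
      hence "\<bar>a x\<bar> \<le> \<eta>" "\<bar>a y\<bar> \<le> \<eta>" using assms(2) xy by (simp_all add: a(1))
      thus ?thesis by linarith
    qed
    assume "x \<noteq> y"
    moreover have "cis ((x0 + a x) - (x0 + a y)) = cis (x - y)"
      by (simp only: cis_divide[symmetric] c)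
    ultimately show "\<Delta> \<le> \<bar>(x0 + a x) - (x0 + a y)\<bar>"
      using wrap_dist_le_lift assms(1) xy order_trans by blast
  qed
qed

section \<open>Lower bound for a single cluster\<close>

lemma separated_chain:
  fixes y b \<Delta> :: real
  assumes "finite T" "\<And>s t. s \<in> T \<Longrightarrow> t \<in> T \<Longrightarrow> s \<noteq> t \<Longrightarrow> \<Delta> \<le> \<bar>s - t\<bar>"
    and "\<And>t. t \<in> T \<Longrightarrow> y + \<Delta> \<le> t" "\<And>t. t \<in> T \<Longrightarrow> t + \<Delta> \<le> b" "y + \<Delta> \<le> b"
  shows "y + (real (card T) + 1) * \<Delta> \<le> b"
  using assms
proof (induction T arbitrary: b rule: finite_linorder_max_induct)
  case empty
  thus ?case by simp
next
  case (insert m T)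
  have "y + (real (card T) + 1) * \<Delta> \<le> m"
  proof (rule insert.IH)
    show "t + \<Delta> \<le> m" if "t \<in> T" for t
      using insert.prems(1)[of m t] insert.hyps that by fastforce
  qed (use insert.prems in auto)
  moreover have "m + \<Delta> \<le> b" using insert.prems by simp
  moreover have "m \<notin> T" using insert.hyps by auto
  ultimately show ?case using insert.hyps by (simp add: algebra_simps)
qed

lemma prod_distances_above:
  fixes y \<Delta> :: real
  assumes "finite T" "\<Delta> \<ge> 0" "\<And>s t. s \<in> T \<Longrightarrow> t \<in> T \<Longrightarrow> s \<noteq> t \<Longrightarrow> \<Delta> \<le> \<bar>s - t\<bar>"
    and "\<And>t. t \<in> T \<Longrightarrow> y + \<Delta> \<le> t"
  shows "\<Delta> ^ card T * fact (card T) \<le> (\<Prod>t\<in>T. t - y)"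
  using assms
proof (induction T rule: finite_linorder_max_induct)
  case empty
  thus ?case by simp
next
  case (insert m T)
  have m: "m \<notin> T" using insert.hyps by auto
  have "y + (real (card T) + 1) * \<Delta> \<le> m"
  proof (rule separated_chain)
    show "t + \<Delta> \<le> m" if "t \<in> T" for t
      using insert.prems(2)[of m t] insert.hyps that by fastforce
  qed (use insert in auto)
  hence 1: "(real (card T) + 1) * \<Delta> \<le> m - y" by simp
  have 2: "\<Delta> ^ card T * fact (card T) \<le> (\<Prod>t\<in>T. t - y)" using insert by simp
  have "((real (card T) + 1) * \<Delta>) * (\<Delta> ^ card T * fact (card T)) \<le> (m - y) * (\<Prod>t\<in>T. t - y)"
  proof (intro mult_mono 1 2)
    show "0 \<le> m - y" using insert.prems(1) insert.prems(3)[of m] by simp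
  qed (use insert.prems(1) in auto)
  thus ?case using insert.hyps m by (simp add: algebra_simps)
qed

text \<open>
  On either side of \<open>y\<close> the distances are at least \<open>\<Delta>, 2 * \<Delta>, \<dots>\<close>. If \<open>r\<close> points lie on one
  side, the product of the two factorials is \<open>fact n / (n choose r)\<close>, which is at least \<open>fact n / 2 ^ n\<close>.
\<close>
lemma prod_distances:
  fixes y \<Delta> :: real
  assumes T: "finite T" and D: "\<Delta> \<ge> 0" and sep: "\<And>s t. s \<in> T \<Longrightarrow> t \<in> T \<Longrightarrow> s \<noteq> t \<Longrightarrow> \<Delta> \<le> \<bar>s - t\<bar>"
    and y: "\<And>t. t \<in> T \<Longrightarrow> \<Delta> \<le> \<bar>y - t\<bar>" "y \<notin> T"
  shows "\<Delta> ^ card T * fact (card T) / 2 ^ card T \<le> (\<Prod>t\<in>T. \<bar>y - t\<bar>)"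
proof -
  define R where "R = {t \<in> T. y < t}"
  define L where "L = {t \<in> T. t < y}"
  have fin: "finite R" "finite L" unfolding R_def L_def using T by auto
  have T_eq: "T = R \<union> L" "R \<inter> L = {}" unfolding R_def L_def using y(2) by (auto simp: not_less_iff_gr_or_eq)
  have card: "card T = card R + card L" unfolding T_eq(1) using fin T_eq(2) by (rule card_Un_disjoint)
  have R: "\<Delta> ^ card R * fact (card R) \<le> (\<Prod>t\<in>R. t - y)"
    by (rule prod_distances_above[OF fin(1) D]) (use sep y(1) in \<open>force simp: R_def\<close>)+
  have inj: "inj_on uminus L" by (simp add: inj_on_def)
  have "\<Delta> ^ card (uminus ` L) * fact (card (uminus ` L)) \<le> (\<Prod>t\<in>uminus ` L. t - (- y))"
  proof (rule prod_distances_above)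
    show "\<Delta> \<le> \<bar>s - t\<bar>" if "s \<in> uminus ` L" "t \<in> uminus ` L" "s \<noteq> t" for s t
      using that sep[of "- s" "- t"] by (force simp: L_def abs_minus_commute)
    show "- y + \<Delta> \<le> t" if "t \<in> uminus ` L" for t
      using that y(1)[of "- t"] by (force simp: L_def)
  qed (use fin D in auto)
  hence L: "\<Delta> ^ card L * fact (card L) \<le> (\<Prod>t\<in>L. y - t)"
    by (simp add: card_image[OF inj] prod.reindex[OF inj])
  have "fact (card T) \<le> (fact (card R) * fact (card L) * 2 ^ card T :: nat)"
  proof -
    have "fact (card T) = (fact (card R) * fact (card T - card R) * (card T choose card R) :: nat)"
      by (rule binomial_fact_lemma[symmetric]) (simp add: card)
    also have "\<dots> \<le> fact (card R) * fact (card T - card R) * 2 ^ card T"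
      by (intro mult_left_mono binomial_le_pow2) auto
    finally show ?thesis by (simp add: card)
  qed
  hence "real (fact (card T)) \<le> real (fact (card R) * fact (card L) * 2 ^ card T)" by (rule of_nat_mono)
  hence f: "fact (card T) / 2 ^ card T \<le> (fact (card R) * fact (card L) :: real)"
    by (simp add: divide_le_eq)
  have "\<Delta> ^ card T * fact (card T) / 2 ^ card T \<le> \<Delta> ^ card T * (fact (card R) * fact (card L))"
    using mult_left_mono[OF f, of "\<Delta> ^ card T"] D by simp
  also have "\<dots> = (\<Delta> ^ card R * fact (card R)) * (\<Delta> ^ card L * fact (card L))"
    by (simp add: card power_add mult_ac)
  also have "\<dots> \<le> (\<Prod>t\<in>R. t - y) * (\<Prod>t\<in>L. y - t)"
    using D by (intro mult_mono R L) (auto simp: R_def intro!: prod_nonneg)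
  also have "(\<Prod>t\<in>R. t - y) = (\<Prod>t\<in>R. \<bar>y - t\<bar>)" by (intro prod.cong) (auto simp: R_def)
  also have "(\<Prod>t\<in>L. y - t) = (\<Prod>t\<in>L. \<bar>y - t\<bar>)" by (intro prod.cong) (auto simp: L_def)
  also have "(\<Prod>t\<in>R. \<bar>y - t\<bar>) * (\<Prod>t\<in>L. \<bar>y - t\<bar>) = (\<Prod>t\<in>T. \<bar>y - t\<bar>)"
    unfolding T_eq(1) by (rule prod.union_disjoint[symmetric]) (use fin T_eq(2) in auto)
  finally show ?thesis .
qed

lemma power_self_le_fact_exp: "real q ^ q \<le> fact q * exp (real q)"
proof -
  have "(\<Sum>n\<in>{q}. real q ^ n /\<^sub>R fact n) \<le> (\<Sum>n. real q ^ n /\<^sub>R fact n)"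
    using summable_exp_generic[of "real q"] by (intro sum_le_suminf) auto
  hence "real q ^ q / fact q \<le> exp (real q)" by (simp add: exp_def divide_inverse mult.commute)
  thus ?thesis by (simp add: divide_le_eq mult.commute)
qed

text \<open>
  The annihilator of the other frequencies isolates the coefficient at \<open>b\<close>. The filtered sequence
  has constant modulus, so its \<open>K + 1\<close> values contribute equally, while filtering increases the
  quadratic norm at most by the absolute sum \<open>2 ^ q\<close> of the coefficients.
\<close>
lemma coefficient_le_l2_norm:
  fixes c w :: "'a \<Rightarrow> complex"
  assumes A: "finite A" "b \<in> A" and w: "\<And>a. a \<in> A \<Longrightarrow> norm (w a) = 1"
    and N: "K + (card A - 1) * h \<le> N"
  shows "real (K + 1) * (norm (c b) * (\<Prod>a\<in>A - {b}. norm (w b ^ h - w a ^ h)))\<^sup>2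
       \<le> 4 ^ (card A - 1) * (\<Sum>k\<le>N. (norm (\<Sum>a\<in>A. c a * w a ^ k))\<^sup>2)"
proof -
  define q where "q = card (A - {b})"
  have q: "card A - 1 = q" using A by (simp add: q_def)
  define Q where "Q = annihilator w h (A - {b})"
  define f where "f k = (\<Sum>a\<in>A. c a * w a ^ k)" for k
  define S where "S = (\<Sum>k\<le>N. (norm (f k))\<^sup>2)"
  define p where "p = (\<Prod>a\<in>A - {b}. norm (w b ^ h - w a ^ h))"
  define \<rho> where "\<rho> j = norm (coeff Q j)" for j
  have degQ: "degree Q = q" unfolding Q_def q_def using A by (simp add: degree_annihilator)
  have \<rho>: "(\<Sum>j\<le>q. \<rho> j) \<le> 2 ^ q"
    unfolding \<rho>_def Q_def q_def using A w by (intro sum_norm_coeff_annihilator) auto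
  have \<rho>0: "\<rho> j \<ge> 0" for j by (simp add: \<rho>_def)
  have S0: "S \<ge> 0" unfolding S_def by (intro sum_nonneg) auto
  have filt: "(\<Sum>j\<le>q. coeff Q j * f (k + j * h)) = c b * w b ^ k * poly Q (w b ^ h)" for k
  proof -
    have "(\<Sum>j\<le>q. coeff Q j * f (k + j * h)) = (\<Sum>a\<in>A. c a * w a ^ k * poly Q (w a ^ h))"
      unfolding f_def by (rule poly_filter_exponential_sum[OF A(1)]) (simp add: degQ)
    also have "\<dots> = (\<Sum>a\<in>{b}. c a * w a ^ k * poly Q (w a ^ h))"
      using A by (intro sum.mono_neutral_right) (auto simp: Q_def poly_annihilator prod_zero_iff)
    finally show ?thesis by simp
  qed
  have pointwise: "(norm (c b) * p)\<^sup>2 \<le> 2 ^ q * (\<Sum>j\<le>q. \<rho> j * (norm (f (k + j * h)))\<^sup>2)" for k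
  proof -
    have "norm (c b) * p = norm (c b * w b ^ k * poly Q (w b ^ h))"
      using w[OF A(2)] by (simp add: norm_mult norm_power Q_def poly_annihilator p_def prod_norm)
    also have "\<dots> \<le> (\<Sum>j\<le>q. \<rho> j * norm (f (k + j * h)))"
      unfolding filt[symmetric] \<rho>_def by (rule sum_norm_le) (simp add: norm_mult)
    also have "\<dots> = (\<Sum>j\<le>q. sqrt (\<rho> j) * (sqrt (\<rho> j) * norm (f (k + j * h))))"
      using \<rho>0 by (simp flip: mult.assoc)
    finally have "(norm (c b) * p)\<^sup>2 \<le> (\<Sum>j\<le>q. sqrt (\<rho> j) * (sqrt (\<rho> j) * norm (f (k + j * h))))\<^sup>2"
      by (rule power_mono) (auto simp: p_def intro!: mult_nonneg_nonneg prod_nonneg)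
    also have "\<dots> \<le> (\<Sum>j\<le>q. (sqrt (\<rho> j))\<^sup>2) * (\<Sum>j\<le>q. (sqrt (\<rho> j) * norm (f (k + j * h)))\<^sup>2)"
      by (rule Cauchy_Schwarz_ineq_sum)
    also have "\<dots> = (\<Sum>j\<le>q. \<rho> j) * (\<Sum>j\<le>q. \<rho> j * (norm (f (k + j * h)))\<^sup>2)"
      using \<rho>0 by (simp add: power_mult_distrib)
    also have "\<dots> \<le> 2 ^ q * (\<Sum>j\<le>q. \<rho> j * (norm (f (k + j * h)))\<^sup>2)"
      using \<rho>0 by (intro mult_right_mono \<rho> sum_nonneg) auto
    finally show ?thesis .
  qed
  have shift: "(\<Sum>k\<le>K. (norm (f (k + j * h)))\<^sup>2) \<le> S" if j: "j \<le> q" for j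
  proof -
    have "(\<Sum>k\<le>K. (norm (f (k + j * h)))\<^sup>2) = (\<Sum>k\<in>(\<lambda>k. k + j * h) ` {..K}. (norm (f k))\<^sup>2)"
      by (subst sum.reindex) auto
    also have "\<dots> \<le> S" unfolding S_def
    proof (intro sum_mono2)
      have "j * h \<le> q * h" using j by simp
      hence "k + j * h \<le> N" if "k \<le> K" for k using that N unfolding q by linarith
      thus "(\<lambda>k. k + j * h) ` {..K} \<subseteq> {..N}" by auto
    qed auto
    finally show ?thesis .
  qed
  have "real (K + 1) * (norm (c b) * p)\<^sup>2 = (\<Sum>k\<le>K. (norm (c b) * p)\<^sup>2)" by simp
  also have "\<dots> \<le> (\<Sum>k\<le>K. 2 ^ q * (\<Sum>j\<le>q. \<rho> j * (norm (f (k + j * h)))\<^sup>2))"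
    by (intro sum_mono pointwise)
  also have "\<dots> = 2 ^ q * (\<Sum>j\<le>q. \<rho> j * (\<Sum>k\<le>K. (norm (f (k + j * h)))\<^sup>2))"
    unfolding sum_distrib_left by (rule sum.swap)
  also have "\<dots> \<le> 2 ^ q * (\<Sum>j\<le>q. \<rho> j * S)"
    using \<rho>0 by (intro mult_left_mono sum_mono shift) auto
  also have "\<dots> = 2 ^ q * ((\<Sum>j\<le>q. \<rho> j) * S)" by (simp add: sum_distrib_right)
  also have "\<dots> \<le> 2 ^ q * (2 ^ q * S)" by (intro mult_left_mono mult_right_mono \<rho> S0) auto
  also have "\<dots> = (2 ^ q * 2 ^ q) * S" by (simp only: mult.assoc)
  also have "2 ^ q * 2 ^ q = (4 ^ q :: real)" by (simp flip: power_mult_distrib)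
  finally show ?thesis unfolding q S_def f_def p_def .
qed

lemma quadratic_le_pi_power: "2 * real q * real (q + 1) \<le> (pi\<^sup>2) ^ q"
proof (cases "q = 0")
  case False
  hence "q > 0" by simp
  hence "2 * real q * real (q + 1) \<le> 4 ^ q"
  proof (induction q rule: nat_induct_non_zero)
    case (Suc n)
    have "2 * real (Suc n) * real (Suc n + 1) \<le> 4 * (2 * real n * real (n + 1))"
    proof -
      have "real (Suc n) * (real n + 2) \<le> real (Suc n) * (4 * real n)"
        using Suc.hyps by (intro mult_left_mono) auto
      thus ?thesis by (simp add: algebra_simps)
    qed
    also have "\<dots> \<le> 4 * 4 ^ n" using Suc.IH by linarith
    finally show ?case by simp
  qed auto
  also have "\<dots> \<le> (pi\<^sup>2) ^ q"
    using power_mono[of 2 pi 2] pi_ge_two by (intro power_mono) auto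
  finally show ?thesis .
qed simp

text \<open>
  A step \<open>h \<ge> N / (4 * q)\<close> with \<open>q * h \<le> N\<close> leaves \<open>K + 1 \<ge> N / (2 * q)\<close> usable starting points.
  Chords of the magnified nodes are at least half as long as the arcs, which gives a product of chords of
  at least \<open>g ^ q\<close> for \<open>g = N * \<Delta> / (16 * exp 1)\<close>. The remaining losses, a factor \<open>2 ^ q\<close> from the
  annihilator and a polynomial factor from \<open>K\<close> and from the summation over the \<open>q + 1\<close> coefficients,
  are absorbed by the \<open>q\<close>-th power of the ratio \<open>2 * pi\<close> of \<open>32 * pi * exp 1\<close> to \<open>16 * exp 1\<close>.
\<close>
lemma single_cluster_lower_bound:
  fixes c w :: "'a \<Rightarrow> complex" and y :: "'a \<Rightarrow> real"
  assumes A: "finite A" "card A = Suc q" and w: "\<And>a. a \<in> A \<Longrightarrow> w a = cis (y a)"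
    and D: "\<Delta> > 0" and sep: "\<And>a b. a \<in> A \<Longrightarrow> b \<in> A \<Longrightarrow> a \<noteq> b \<Longrightarrow> \<Delta> \<le> \<bar>y a - y b\<bar>"
    and close: "\<And>a b. a \<in> A \<Longrightarrow> b \<in> A \<Longrightarrow> real N * \<bar>y a - y b\<bar> \<le> 1"
    and N: "q \<le> N"
  shows "real N * (real N * \<Delta> / (32 * pi * exp 1)) ^ (2 * q) * (\<Sum>a\<in>A. (norm (c a))\<^sup>2)
       \<le> (\<Sum>k\<le>N. (norm (\<Sum>a\<in>A. c a * w a ^ k))\<^sup>2)"
proof -
  define S where "S = (\<Sum>k\<le>N. (norm (\<Sum>a\<in>A. c a * w a ^ k))\<^sup>2)"
  have S0: "S \<ge> 0" unfolding S_def by (intro sum_nonneg) auto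
  have norm_w: "norm (w a) = 1" if "a \<in> A" for a using w[OF that] by simp
  show ?thesis
  proof (cases "q = 0")
    case True
    then obtain a where a: "A = {a}" using A(2) by (metis card_1_singletonE One_nat_def)
    show ?thesis using True norm_w by (simp add: a norm_mult norm_power mult_right_mono)
  next
    case False
    (* The maximum matters for q \<le> N < 2 * q, where the quotient is 0 but step 1 still fits. *)
    define h where "h = max 1 (N div (2 * q))"
    have hq: "q * h \<le> N"
    proof (cases "N div (2 * q) \<ge> 1")
      case True
      have "q * (N div (2 * q)) \<le> (N div (2 * q)) * (2 * q)" by simp
      also have "\<dots> \<le> N" by simp
      finally show ?thesis using True unfolding h_def by (simp add: max_def)
    qed (use N in \<open>simp add: h_def max_def\<close>)
    define K where "K = N - q * h"
    have N0: "real N > 0" using N False by simp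
    have h0: "real h > 0" "h \<le> N" using hq False by (auto simp: h_def intro: order_trans[OF _ hq])
    have split: "N = (N div (2 * q)) * (2 * q) + N mod (2 * q)" by (rule div_mult_mod_eq[symmetric])
    have mod: "N mod (2 * q) < 2 * q" using False by (intro mod_less_divisor) simp
    have h_ge: "N \<le> 4 * q * h"
    proof -
      have "(N div (2 * q)) * (2 * q) \<le> h * (2 * q)" unfolding h_def by (intro mult_right_mono) auto
      moreover have "1 * (2 * q) \<le> h * (2 * q)" unfolding h_def by (intro mult_right_mono) auto
      moreover have "4 * q * h = 2 * (h * (2 * q))" by simp
      ultimately show ?thesis using split mod by linarith
    qed
    have K_ge: "N \<le> 2 * q * (K + 1)"
    proof (cases "N div (2 * q) \<ge> 1")
      case True
      hence "2 * (q * h) \<le> N" using split unfolding h_def by (simp add: max_def mult_ac)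
      hence "N \<le> 2 * K" unfolding K_def by linarith
      also have "2 * K \<le> 2 * (q * (K + 1))"
      proof -
        have "1 * (K + 1) \<le> q * (K + 1)" using False by (intro mult_right_mono) auto
        hence "K \<le> q * (K + 1)" by (rule order_trans[rotated]) simp
        thus ?thesis by (rule mult_left_mono) simp
      qed
      finally show ?thesis by (simp only: mult.assoc)
    next
      case False
      hence "N div (2 * q) = 0" by simp
      hence "N < 2 * q" using split mod by (metis add_0 mult_0)
      thus ?thesis by (simp add: add_increasing)
    qed
    define g where "g = real N * \<Delta> / (16 * exp 1)"
    have g0: "g \<ge> 0" using D by (simp add: g_def)
    have coeff: "real N * g ^ (2 * q) * (norm (c b))\<^sup>2 \<le> 2 * real q * 4 ^ q * S" if b: "b \<in> A" for b
    proof -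
      have inj: "inj_on y (A - {b})"
      proof (rule inj_onI)
        fix s t assume "s \<in> A - {b}" "t \<in> A - {b}" "y s = y t"
        thus "s = t" using sep[of s t] D by fastforce
      qed
      have card: "card (A - {b}) = q" using A b by simp
      have cardy: "card (y ` (A - {b})) = q" by (simp only: card_image[OF inj] card)
      have "\<Delta> ^ card (y ` (A - {b})) * fact (card (y ` (A - {b}))) / 2 ^ card (y ` (A - {b}))
          \<le> (\<Prod>t\<in>y ` (A - {b}). \<bar>y b - t\<bar>)"
      proof (rule prod_distances)
        show "\<Delta> \<le> \<bar>s - t\<bar>" if "s \<in> y ` (A - {b})" "t \<in> y ` (A - {b})" "s \<noteq> t" for s t
          using that sep by auto
        show "\<Delta> \<le> \<bar>y b - t\<bar>" if "t \<in> y ` (A - {b})" for t using that sep b by auto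
        show "y b \<notin> y ` (A - {b})" using sep[OF b] D by fastforce
      qed (use A D in auto)
      hence prod_y: "\<Delta> ^ q * fact q / 2 ^ q \<le> (\<Prod>a\<in>A - {b}. \<bar>y b - y a\<bar>)"
        unfolding cardy prod.reindex[OF inj] by simp
      have "(real h / 2) ^ q * (\<Prod>a\<in>A - {b}. \<bar>y b - y a\<bar>) = (\<Prod>a\<in>A - {b}. real h / 2 * \<bar>y b - y a\<bar>)"
        by (simp only: prod.distrib prod_constant card)
      also have "\<dots> \<le> (\<Prod>a\<in>A - {b}. norm (w b ^ h - w a ^ h))"
      proof (intro prod_mono conjI)
        fix a assume a: "a \<in> A - {b}"
        have e: "real h * y b - real h * y a = real h * (y b - y a)" by (simp add: algebra_simps)
        have "real h * \<bar>y b - y a\<bar> \<le> real N * \<bar>y b - y a\<bar>" using h0 by (intro mult_right_mono) auto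
        also have "\<dots> \<le> 1" using close a b by auto
        finally have "\<bar>real h * y b - real h * y a\<bar> \<le> 1" unfolding e by (simp add: abs_mult)
        from norm_cis_diff_ge[OF this]
        have "real h * \<bar>y b - y a\<bar> / 2 \<le> norm (cis (real h * y b) - cis (real h * y a))"
          unfolding e by (simp add: abs_mult)
        thus "real h / 2 * \<bar>y b - y a\<bar> \<le> norm (w b ^ h - w a ^ h)"
          using a b by (simp add: w Complex.DeMoivre)
      qed simp
      finally have prod_w: "(real h / 2) ^ q * (\<Prod>a\<in>A - {b}. \<bar>y b - y a\<bar>) \<le> (\<Prod>a\<in>A - {b}. norm (w b ^ h - w a ^ h))" .
      have "g ^ q \<le> (real h / 2) ^ q * (\<Delta> ^ q * fact q / 2 ^ q)"
      proof -
        have "real N \<le> 4 * real q * real h" using of_nat_mono[OF h_ge, where 'a = real] by simp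
        hence "g \<le> (4 * real q * real h) * \<Delta> / (16 * exp 1)"
          unfolding g_def using D by (intro divide_right_mono mult_right_mono) auto
        also have "\<dots> = (real h * \<Delta> / 4) * (real q / exp 1)" by simp
        finally have "g ^ q \<le> ((real h * \<Delta> / 4) * (real q / exp 1)) ^ q" using g0 by (rule power_mono)
        also have "\<dots> = (real h * \<Delta> / 4) ^ q * (real q ^ q / exp (real q))"
          by (simp add: power_mult_distrib power_divide exp_of_nat_mult[of q 1, simplified])
        also have "\<dots> \<le> (real h * \<Delta> / 4) ^ q * fact q"
          using power_self_le_fact_exp[of q] D by (intro mult_left_mono) (auto simp: divide_le_eq)
        also have "(real h * \<Delta> / 4) ^ q = (real h / 2) ^ q * (\<Delta> ^ q / 2 ^ q)"
        proof -
          have "real h * \<Delta> / 4 = (real h / 2) * (\<Delta> / 2)" by simp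
          thus ?thesis by (simp only: power_mult_distrib power_divide)
        qed
        finally show ?thesis by (simp add: mult_ac)
      qed
      also have "\<dots> \<le> (real h / 2) ^ q * (\<Prod>a\<in>A - {b}. \<bar>y b - y a\<bar>)"
        by (intro mult_left_mono prod_y) simp
      also note prod_w
      finally have gq: "g ^ q \<le> (\<Prod>a\<in>A - {b}. norm (w b ^ h - w a ^ h))" .
      have "real N * g ^ (2 * q) * (norm (c b))\<^sup>2 = real N * (norm (c b) * g ^ q)\<^sup>2"
        unfolding power_even_eq power_mult_distrib by simp
      also have "\<dots> \<le> real (2 * q * (K + 1)) * (norm (c b) * (\<Prod>a\<in>A - {b}. norm (w b ^ h - w a ^ h)))\<^sup>2"
        using g0 by (intro mult_mono of_nat_mono K_ge power_mono mult_left_mono gq) auto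
      also have "\<dots> = 2 * real q * (real (K + 1) * (norm (c b) * (\<Prod>a\<in>A - {b}. norm (w b ^ h - w a ^ h)))\<^sup>2)"
        by (simp only: of_nat_mult of_nat_numeral mult.assoc)
      also have "\<dots> \<le> 2 * real q * (4 ^ (card A - 1) * S)"
        unfolding S_def
        by (intro mult_left_mono coefficient_le_l2_norm A b norm_w) (use hq in \<open>auto simp: A K_def mult.commute\<close>)
      finally show ?thesis by (simp add: A)
    qed
    have "real N * (real N * \<Delta> / (32 * pi * exp 1)) ^ (2 * q) * (\<Sum>a\<in>A. (norm (c a))\<^sup>2)
        = (\<Sum>a\<in>A. real N * g ^ (2 * q) * (norm (c a))\<^sup>2) / (2 * pi) ^ (2 * q)"
    proof -
      have "real N * \<Delta> / (32 * pi * exp 1) = g / (2 * pi)" by (simp add: g_def)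
      thus ?thesis by (simp only: power_divide sum_distrib_left[symmetric]) simp
    qed
    also have "\<dots> \<le> (\<Sum>a\<in>A. 2 * real q * 4 ^ q * S) / (2 * pi) ^ (2 * q)"
      by (intro divide_right_mono sum_mono coeff) auto
    also have "\<dots> = (2 * real q * real (q + 1)) * (4 ^ q * S) / (2 * pi) ^ (2 * q)"
      by (simp add: A)
    also have "\<dots> \<le> (pi\<^sup>2) ^ q * (4 ^ q * S) / (2 * pi) ^ (2 * q)"
      by (intro divide_right_mono mult_right_mono quadratic_le_pi_power) (use S0 in auto)
    also have "(2 * pi) ^ (2 * q) = (pi\<^sup>2) ^ q * 4 ^ q"
      unfolding power_mult by (simp add: power_mult_distrib mult.commute)
    finally show ?thesis unfolding S_def by simp
  qed
qed

section \<open>Separated clusters are almost orthogonal\<close>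

text \<open>
  The power of \<open>4\<close> and the first \<open>l\<^sup>2\<close> come from the cancellation among the at most \<open>l\<^sup>2\<close> frequencies
  of a product of two sums, \<open>pi\<close> from a step of at most \<open>pi / \<theta>\<close>, and the last factor from
  bounding the values of both sums by their quadratic means.
\<close>

definition cross_constant :: "nat \<Rightarrow> real" where
  "cross_constant l = 4 ^ (l\<^sup>2) * (real l)\<^sup>2 * pi * (4 ^ (l + 1) * (real l)\<^sup>2)"

text \<open>
  The product \<open>f * cnj g\<close> is an exponential sum whose frequencies \<open>cis (x - z)\<close> all lie close
  to \<open>cis (x0 - z0)\<close> for fixed nodes \<open>x0\<close>, \<open>z0\<close>. With \<open>\<delta>\<close> the distance of \<open>x0\<close> and \<open>z0\<close> and
  \<open>t\<close> the integer part of \<open>pi / \<delta>\<close>, the angle \<open>t * \<delta>\<close> lies between \<open>pi / 2\<close> and \<open>pi\<close>, so the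
  \<open>t\<close>-th power of the central frequency has nonpositive real part and is at distance at least \<open>1\<close>
  from \<open>1\<close>. The other frequencies follow because the clusters are narrow compared with \<open>\<theta>\<close>.
\<close>
lemma separated_clusters_almost_orthogonal:
  fixes A B :: "real set" and c d :: "real \<Rightarrow> complex"
  assumes fin: "finite A" "finite B" and card: "card A \<le> l" "card B \<le> l"
    and \<theta>: "\<theta> > 0" and sep: "\<And>x z. x \<in> A \<Longrightarrow> z \<in> B \<Longrightarrow> \<theta> \<le> wrap_dist x z"
    and A: "\<And>x y. x \<in> A \<Longrightarrow> y \<in> A \<Longrightarrow> wrap_dist x y \<le> \<eta>"
    and B: "\<And>x y. x \<in> B \<Longrightarrow> y \<in> B \<Longrightarrow> wrap_dist x y \<le> \<eta>"
    and \<eta>: "4 * pi * \<eta> \<le> \<theta>"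
  defines "f \<equiv> \<lambda>k. \<Sum>x\<in>A. c x * cis x ^ k" and "g \<equiv> \<lambda>k. \<Sum>x\<in>B. d x * cis x ^ k"
  shows "real N * \<theta> * norm (\<Sum>k\<le>N. f k * cnj (g k))
       \<le> cross_constant l * (sqrt (\<Sum>k\<le>N. (norm (f k))\<^sup>2) * sqrt (\<Sum>k\<le>N. (norm (g k))\<^sup>2))"
proof -
  define F where "F = (\<Sum>k\<le>N. (norm (f k))\<^sup>2)"
  define G where "G = (\<Sum>k\<le>N. (norm (g k))\<^sup>2)"
  have FG0: "F \<ge> 0" "G \<ge> 0" unfolding F_def G_def by (auto intro: sum_nonneg)
  have K0: "cross_constant l \<ge> 0" unfolding cross_constant_def by simp
  show ?thesis
  proof (cases "A = {} \<or> B = {} \<or> N = 0")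
    case True
    thus ?thesis using K0 FG0 by (auto simp: f_def g_def intro!: mult_nonneg_nonneg)
  next
    case False
    then obtain x0 z0 where x0: "x0 \<in> A" and z0: "z0 \<in> B" and N: "real N > 0" by auto
    define \<delta> where "\<delta> = wrap_dist x0 z0"
    have \<delta>: "\<theta> \<le> \<delta>" "\<delta> \<le> pi" unfolding \<delta>_def using sep[OF x0 z0] wrap_dist_le_pi by auto
    define t where "t = nat \<lfloor>pi / \<delta>\<rfloor>"
    have floor: "real t = of_int \<lfloor>pi / \<delta>\<rfloor>" using \<delta> \<theta> by (simp add: t_def)
    have "1 \<le> pi / \<delta>" using \<delta> \<theta> by simp
    hence t1: "real t \<ge> 1" unfolding floor by simp
    have "real t \<le> pi / \<delta>" unfolding floor by simp
    hence t_le: "real t * \<delta> \<le> pi" using \<delta> \<theta> by (simp add: le_divide_eq)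
    have "pi / \<delta> < real t + 1" unfolding floor by linarith
    hence "pi < (real t + 1) * \<delta>" using \<delta> \<theta> by (simp add: divide_less_eq)
    also have "\<dots> \<le> (2 * real t) * \<delta>" using t1 \<delta> \<theta> by (intro mult_right_mono) auto
    finally have t_ge: "pi / 2 \<le> real t * \<delta>" by simp
    have t\<theta>: "real t * \<theta> \<le> pi" using mult_left_mono[OF \<delta>(1), of "real t"] t_le by simp
    let ?w = "\<lambda>(x, z). cis x * cnj (cis z)"
    let ?h = "\<lambda>k. f k * cnj (g k)"
    define r where "r = card (A \<times> B)"
    obtain a where a: "\<bar>a\<bar> = \<delta>" "cis a = cis (x0 - z0)" unfolding \<delta>_def by (rule wrap_dist_lift)
    have w0: "?w (x0, z0) = cis a" unfolding a by (simp add: cis_cnj cis_mult)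
    have "cos (real t * a) = cos (real t * \<delta>)" using a(1) by (cases "a \<ge> 0") auto
    also have "\<dots> = - sin (real t * \<delta> - pi / 2)" by (simp add: sin_diff)
    also have "\<dots> \<le> 0" using sin_ge_zero[of "real t * \<delta> - pi / 2"] t_ge t_le by simp
    finally have "1 \<le> Re (1 - cis a ^ t)" by (simp add: Complex.DeMoivre)
    also have "\<dots> \<le> norm (1 - cis a ^ t)" by (rule complex_Re_le_cmod)
    finally have centre: "1 \<le> norm (1 - cis a ^ t)" .
    define Bd where "Bd = sqrt (4 ^ (l + 1) * (real l)\<^sup>2 * F / real N) * sqrt (4 ^ (l + 1) * (real l)\<^sup>2 * G / real N)"
    have sup: "norm (u k) \<le> sqrt (4 ^ (l + 1) * (real l)\<^sup>2 * (\<Sum>k\<le>N. (norm (u k))\<^sup>2) / real N)"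
      if u: "u = (\<lambda>k. \<Sum>x\<in>C. e x * cis x ^ k)" and C: "finite C" "card C \<le> l" and k: "k \<le> N" for u C e k
    proof (rule real_le_rsqrt)
      have "(norm (u k))\<^sup>2 * real N \<le> 4 ^ (card C + 1) * (real (card C))\<^sup>2 * (\<Sum>k\<le>N. (norm (u k))\<^sup>2)"
        by (rule norm_le_l2_norm[OF C(1) _ _ k, where w = cis and c = e]) (auto simp: u)
      also have "\<dots> \<le> 4 ^ (l + 1) * (real l)\<^sup>2 * (\<Sum>k\<le>N. (norm (u k))\<^sup>2)"
        using C(2) by (intro mult_mono power_increasing power_mono) (auto intro: sum_nonneg)
      finally show "(norm (u k))\<^sup>2 \<le> 4 ^ (l + 1) * (real l)\<^sup>2 * (\<Sum>k\<le>N. (norm (u k))\<^sup>2) / real N"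
        using N by (simp add: le_divide_eq)
    qed
    have "norm (\<Sum>k\<le>N. ?h k) \<le> 4 ^ r * (real r * real t * Bd)"
      unfolding r_def
    proof (rule sum_exponential_sum_bound[where w = ?w and c = "\<lambda>(x, z). c x * cnj (d z)"])
      show "norm (?w p) = 1" if "p \<in> A \<times> B" for p by (cases p) (simp add: norm_mult)
      show "?h k = (\<Sum>p\<in>A \<times> B. (case p of (x, z) \<Rightarrow> c x * cnj (d z)) * ?w p ^ k)" for k
        by (simp add: f_def g_def sum_product sum.cartesian_product case_prod_beta power_mult_distrib mult_ac)
      show "norm (?h k) \<le> Bd" if "k \<le> N" for k
        unfolding norm_mult complex_mod_cnj Bd_def F_def G_def
        by (intro mult_mono sup[OF _ fin(1) card(1) that] sup[OF _ fin(2) card(2) that])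
          (auto simp: f_def g_def intro!: divide_nonneg_nonneg mult_nonneg_nonneg sum_nonneg)
      show "1 / 2 \<le> norm (1 - ?w p ^ t)" if "p \<in> A \<times> B" for p
      proof -
        obtain x z where p: "p = (x, z)" "x \<in> A" "z \<in> B" using \<open>p \<in> A \<times> B\<close> by auto
        have "?w p - cis a = (cis x - cis x0) * cnj (cis z) + cis x0 * cnj (cis z - cis z0)"
          unfolding w0[symmetric] p by (simp add: algebra_simps)
        also have "norm \<dots> \<le> norm (cis x - cis x0) + norm (cis z - cis z0)"
          by (rule order_trans[OF norm_triangle_ineq]) (simp add: norm_mult flip: complex_cnj_diff)
        also have "\<dots> \<le> \<eta> + \<eta>"
          using A[OF p(2) x0] B[OF p(3) z0] norm_cis_diff_le_wrap_dist[of x x0] norm_cis_diff_le_wrap_dist[of z z0]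
          by linarith
        finally have pert: "norm (?w p - cis a) \<le> 2 * \<eta>" by simp
        have "norm (?w p ^ t - cis a ^ t) \<le> real t * norm (?w p - cis a)"
          by (rule norm_power_diff) (auto simp: p norm_mult)
        also have "\<dots> \<le> real t * (2 * \<eta>)" by (intro mult_left_mono pert) simp
        also have "\<dots> \<le> 1 / 2"
        proof -
          have "4 * pi * (real t * \<eta>) = real t * (4 * pi * \<eta>)" by simp
          also have "\<dots> \<le> real t * \<theta>" by (intro mult_left_mono \<eta>) simp
          also note t\<theta>
          finally have "pi * (4 * (real t * \<eta>)) \<le> pi * 1" by simp
          hence "4 * (real t * \<eta>) \<le> 1" by (rule mult_left_le_imp_le) simp
          thus ?thesis by simp
        qed
        finally have "norm (?w p ^ t - cis a ^ t) \<le> 1 / 2" .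
        moreover have "norm (1 - cis a ^ t) \<le> norm (1 - ?w p ^ t) + norm (?w p ^ t - cis a ^ t)"
          using norm_triangle_ineq[of "1 - ?w p ^ t" "?w p ^ t - cis a ^ t"] by simp
        ultimately show ?thesis using centre by linarith
      qed
    qed (use fin in auto)
    also have "Bd = 4 ^ (l + 1) * (real l)\<^sup>2 / real N * (sqrt F * sqrt G)"
    proof -
      define \<kappa> :: real where "\<kappa> = 4 ^ (l + 1) * (real l)\<^sup>2"
      have "\<kappa> \<ge> 0" by (simp add: \<kappa>_def)
      have "Bd = sqrt \<kappa> * sqrt \<kappa> / (sqrt (real N) * sqrt (real N)) * (sqrt F * sqrt G)"
        unfolding Bd_def \<kappa>_def[symmetric] real_sqrt_mult real_sqrt_divide
        by (simp only: times_divide_times_eq times_divide_eq_left times_divide_eq_right divide_divide_eq_left mult_ac)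
      also have "\<dots> = \<kappa> / real N * (sqrt F * sqrt G)" using \<open>\<kappa> \<ge> 0\<close> by simp
      finally show ?thesis unfolding \<kappa>_def .
    qed
    finally have "real N * \<theta> * norm (\<Sum>k\<le>N. ?h k)
        \<le> real N * \<theta> * (4 ^ r * (real r * real t * (4 ^ (l + 1) * (real l)\<^sup>2 / real N * (sqrt F * sqrt G))))"
      using \<theta> by (intro mult_left_mono) auto
    also have "\<dots> = 4 ^ r * real r * (real t * \<theta>) * (4 ^ (l + 1) * (real l)\<^sup>2) * (sqrt F * sqrt G)"
      using N by simp
    also have "\<dots> \<le> 4 ^ (l\<^sup>2) * (real l)\<^sup>2 * pi * (4 ^ (l + 1) * (real l)\<^sup>2) * (sqrt F * sqrt G)"
    proof -
      have "r = card A * card B" unfolding r_def by (rule card_cartesian_product)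
      also have "\<dots> \<le> l * l" using card by (rule mult_mono) auto
      finally have r: "r \<le> l\<^sup>2" by (simp add: power2_eq_square)
      hence "real r \<le> (real l)\<^sup>2" by (metis of_nat_le_iff of_nat_power)
      moreover have "1 \<le> l" using card(1) x0 fin(1) by (metis One_nat_def Suc_leI card_gt_0_iff empty_iff order_trans)
      ultimately show ?thesis using r t\<theta> FG0 \<theta> by (intro mult_mono power_increasing) auto
    qed
    finally show ?thesis unfolding cross_constant_def F_def G_def .
  qed
qed

text \<open>
  The off-diagonal inner products add up to at most \<open>\<epsilon>\<close> times the square of the sum of the norms, and
  the Cauchy--Schwarz inequality compares this square with \<open>card P\<close> times the sum of the squares.
\<close>
lemma almost_orthogonal_sum:
  fixes u :: "'a \<Rightarrow> nat \<Rightarrow> complex"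
  assumes P: "finite P" and \<epsilon>: "\<epsilon> * real (card P) \<le> 1 / 2" "\<epsilon> \<ge> 0"
    and cross: "\<And>C D. C \<in> P \<Longrightarrow> D \<in> P \<Longrightarrow> C \<noteq> D \<Longrightarrow>
      norm (\<Sum>k\<le>N. u C k * cnj (u D k)) \<le> \<epsilon> * (sqrt (\<Sum>k\<le>N. (norm (u C k))\<^sup>2) * sqrt (\<Sum>k\<le>N. (norm (u D k))\<^sup>2))"
  shows "(\<Sum>C\<in>P. \<Sum>k\<le>N. (norm (u C k))\<^sup>2) / 2 \<le> (\<Sum>k\<le>N. (norm (\<Sum>C\<in>P. u C k))\<^sup>2)"
proof -
  define n where "n C = sqrt (\<Sum>k\<le>N. (norm (u C k))\<^sup>2)" for C
  have n0: "n C \<ge> 0" for C unfolding n_def by (intro real_sqrt_ge_zero sum_nonneg) auto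
  have n2: "(\<Sum>k\<le>N. (norm (u C k))\<^sup>2) = (n C)\<^sup>2" for C
    unfolding n_def by (rule real_sqrt_pow2[symmetric]) (intro sum_nonneg, auto)
  define ip where "ip C D = (\<Sum>k\<le>N. u C k * cnj (u D k))" for C D
  have ip_self: "ip C C = complex_of_real ((n C)\<^sup>2)" for C
    unfolding n2[symmetric] ip_def of_real_sum complex_norm_square ..
  have "complex_of_real (\<Sum>k\<le>N. (norm (\<Sum>C\<in>P. u C k))\<^sup>2) = (\<Sum>k\<le>N. \<Sum>C\<in>P. \<Sum>D\<in>P. u C k * cnj (u D k))"
    unfolding of_real_sum complex_norm_square cnj_sum sum_product ..
  also have "\<dots> = (\<Sum>C\<in>P. \<Sum>k\<le>N. \<Sum>D\<in>P. u C k * cnj (u D k))" by (rule sum.swap)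
  also have "\<dots> = (\<Sum>C\<in>P. \<Sum>D\<in>P. ip C D)" unfolding ip_def by (intro sum.cong refl sum.swap)
  finally have "(\<Sum>k\<le>N. (norm (\<Sum>C\<in>P. u C k))\<^sup>2) = Re (\<Sum>C\<in>P. \<Sum>D\<in>P. ip C D)"
    by (metis Re_complex_of_real)
  also have "\<dots> = (\<Sum>C\<in>P. \<Sum>D\<in>P. Re (ip C D))" by simp
  also have "\<dots> \<ge> (\<Sum>C\<in>P. \<Sum>D\<in>P. (if C = D then (n C)\<^sup>2 else 0) - \<epsilon> * (n C * n D))"
  proof (intro sum_mono)
    fix C D assume CD: "C \<in> P" "D \<in> P"
    show "(if C = D then (n C)\<^sup>2 else 0) - \<epsilon> * (n C * n D) \<le> Re (ip C D)"
    proof (cases "C = D")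
      case True
      thus ?thesis using n0[of D] \<epsilon>(2) by (simp add: ip_self)
    next
      case False
      have "norm (ip C D) \<le> \<epsilon> * (n C * n D)" unfolding ip_def n_def by (rule cross[OF CD False])
      thus ?thesis using abs_Re_le_cmod[of "ip C D"] False by simp
    qed
  qed
  also have "(\<Sum>C\<in>P. \<Sum>D\<in>P. (if C = D then (n C)\<^sup>2 else 0) - \<epsilon> * (n C * n D))
      = (\<Sum>C\<in>P. (n C)\<^sup>2) - (\<Sum>C\<in>P. \<Sum>D\<in>P. \<epsilon> * (n C * n D))"
    using P by (simp add: sum_subtractf)
  also have "(\<Sum>C\<in>P. \<Sum>D\<in>P. \<epsilon> * (n C * n D)) = \<epsilon> * (\<Sum>C\<in>P. n C)\<^sup>2"
    by (simp only: power2_eq_square sum_product) (simp only: sum_distrib_left)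
  finally have "(\<Sum>C\<in>P. (n C)\<^sup>2) - \<epsilon> * (\<Sum>C\<in>P. n C)\<^sup>2 \<le> (\<Sum>k\<le>N. (norm (\<Sum>C\<in>P. u C k))\<^sup>2)" .
  moreover have "\<epsilon> * (\<Sum>C\<in>P. n C)\<^sup>2 \<le> (\<Sum>C\<in>P. (n C)\<^sup>2) / 2"
  proof -
    have "(\<Sum>C\<in>P. n C)\<^sup>2 \<le> real (card P) * (\<Sum>C\<in>P. (n C)\<^sup>2)"
      using Cauchy_Schwarz_ineq_sum[of "\<lambda>_. 1" n P] by simp
    hence "\<epsilon> * (\<Sum>C\<in>P. n C)\<^sup>2 \<le> \<epsilon> * (real (card P) * (\<Sum>C\<in>P. (n C)\<^sup>2))"
      using \<epsilon>(2) by (rule mult_left_mono)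
    also have "\<dots> = (\<epsilon> * real (card P)) * (\<Sum>C\<in>P. (n C)\<^sup>2)" by simp
    also have "\<dots> \<le> 1 / 2 * (\<Sum>C\<in>P. (n C)\<^sup>2)" by (intro mult_right_mono \<epsilon>(1) sum_nonneg) auto
    finally show ?thesis by simp
  qed
  ultimately show ?thesis unfolding n2 by linarith
qed

section \<open>Counting singular values by a coordinate subspace\<close>

lemma mat_adjoint_carrier: "A \<in> carrier_mat m n \<Longrightarrow> mat_adjoint A \<in> carrier_mat n m"
  unfolding mat_adjoint_def by (metis carrier_matD mat_of_rows_carrier(1) length_map cols_length)

lemma index_mat_adjoint:
  fixes A :: "complex mat"
  shows "A \<in> carrier_mat m n \<Longrightarrow> i < n \<Longrightarrow> j < m \<Longrightarrow> mat_adjoint A $$ (i, j) = cnj (A $$ (j, i))"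
  unfolding mat_adjoint_def by (simp add: mat_of_rows_index conjugate_complex_def)

lemma index_mult_sum:
  "A \<in> carrier_mat m n \<Longrightarrow> B \<in> carrier_mat n r \<Longrightarrow> i < m \<Longrightarrow> j < r
   \<Longrightarrow> (A * B) $$ (i, j) = (\<Sum>k<n. A $$ (i, k) * B $$ (k, j))"
  by (auto simp: scalar_prod_def atLeast0LessThan intro!: sum.cong)

lemma mat_adjoint_mult:
  fixes A B :: "complex mat"
  assumes A: "A \<in> carrier_mat m n" and B: "B \<in> carrier_mat n r"
  shows "mat_adjoint (A * B) = mat_adjoint B * mat_adjoint A"
proof (rule eq_matI)
  note cs = mat_adjoint_carrier[OF A] mat_adjoint_carrier[OF B] mult_carrier_mat[OF A B]
    mat_adjoint_carrier[OF mult_carrier_mat[OF A B]]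
    mult_carrier_mat[OF mat_adjoint_carrier[OF B] mat_adjoint_carrier[OF A]]
  show "dim_row (mat_adjoint (A * B)) = dim_row (mat_adjoint B * mat_adjoint A)"
    "dim_col (mat_adjoint (A * B)) = dim_col (mat_adjoint B * mat_adjoint A)"
    using cs by (metis carrier_matD)+
  fix i j assume "i < dim_row (mat_adjoint B * mat_adjoint A)" "j < dim_col (mat_adjoint B * mat_adjoint A)"
  hence ij: "i < r" "j < m" using cs by auto
  show "mat_adjoint (A * B) $$ (i, j) = (mat_adjoint B * mat_adjoint A) $$ (i, j)"
    using ij by (simp add: index_mat_adjoint[OF cs(3)] index_mult_sum[OF cs(2) cs(1)]
        index_mult_sum[OF A B] index_mat_adjoint[OF A] index_mat_adjoint[OF B] mult.commute
        del: index_mult_mat)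
qed

lemma mat_adjoint_adjoint:
  fixes A :: "complex mat"
  assumes A: "A \<in> carrier_mat m n"
  shows "mat_adjoint (mat_adjoint A) = A"
  by (rule eq_matI) (use A mat_adjoint_carrier[OF A] mat_adjoint_carrier[OF mat_adjoint_carrier[OF A]] in
      \<open>auto simp: index_mat_adjoint[OF A] index_mat_adjoint[OF mat_adjoint_carrier[OF A]]\<close>)

definition real_diag :: "nat \<Rightarrow> (nat \<Rightarrow> real) \<Rightarrow> complex mat" where
  "real_diag n d = mat n n (\<lambda>(i, j). if i = j then complex_of_real (d i) else 0)"

lemma real_diag_carrier [simp]: "real_diag n d \<in> carrier_mat n n"
  unfolding real_diag_def by simp

lemma index_conj_diag:
  assumes U: "U \<in> carrier_mat n n" and ij: "i < n" "j < n"
  shows "(U * real_diag n d * mat_adjoint U) $$ (i, j)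
       = (\<Sum>k<n. U $$ (i, k) * complex_of_real (d k) * cnj (U $$ (j, k)))"
proof -
  have "(U * real_diag n d) $$ (i, k) = U $$ (i, k) * complex_of_real (d k)" if k: "k < n" for k
  proof -
    have "(U * real_diag n d) $$ (i, k) = (\<Sum>l<n. U $$ (i, l) * real_diag n d $$ (l, k))"
      by (rule index_mult_sum[OF U real_diag_carrier ij(1) k])
    also have "\<dots> = (\<Sum>l<n. if l = k then U $$ (i, k) * complex_of_real (d k) else 0)"
      using k by (intro sum.cong refl) (auto simp: real_diag_def)
    finally show ?thesis using k by simp
  qed
  thus ?thesis
    using ij by (simp add: index_mult_sum[OF mult_carrier_mat[OF U real_diag_carrier] mat_adjoint_carrier[OF U]]
        index_mat_adjoint[OF U] del: index_mult_mat)
qed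

text \<open>
  A complex matrix has an eigenvector. It is completed to a basis, orthogonalized and normalized; the
  eigenvector becomes the first column, since Gram--Schmidt keeps the direction of the first vector.
\<close>
lemma unitary_extending_eigenvector:
  fixes A :: "complex mat"
  assumes A: "A \<in> carrier_mat n n" and n: "n > 0"
  obtains U e where "U \<in> carrier_mat n n" "mat_adjoint U * U = 1\<^sub>m n"
    "\<And>i. i < n \<Longrightarrow> (A * U) $$ (i, 0) = e * U $$ (i, 0)"
proof -
  obtain as where as: "char_poly A = (\<Prod>a\<leftarrow>as. [:- a, 1:])" "length as = n"
    using char_poly_factorized[OF A] by blast
  then obtain e es where "as = e # es" using n by (cases as) auto
  hence "poly (char_poly A) e = 0" using as by simp
  hence "eigenvalue A e" using eigenvalue_root_char_poly[OF A] by simp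
  then obtain v where "eigenvector A v e" unfolding eigenvalue_def by blast
  hence v: "v \<in> carrier_vec n" and v0: "v \<noteq> 0\<^sub>v n" and Av: "A *\<^sub>v v = e \<cdot>\<^sub>v v"
    using A unfolding eigenvector_def by auto
  interpret cof_vec_space n "TYPE(complex)" .
  define b where "b = basis_completion v"
  define ws where "ws = gram_schmidt n b"
  from basis_completion[OF v v0, folded b_def]
  have dist_b: "distinct b" and indep: "\<not> lin_dep (set b)" and b: "set b \<subseteq> carrier_vec n"
    and hdb: "hd b = v" and len_b: "length b = n" by auto
  from hdb len_b n obtain vs where bv: "b = v # vs" by (cases b) auto
  from gram_schmidt_result[OF b dist_b indep refl, folded ws_def]
  have ws: "set ws \<subseteq> carrier_vec n" "corthogonal ws" "length ws = n" by (auto simp: len_b)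
  from gram_schmidt_hd[OF v, of vs, folded bv] have hdws: "hd ws = v" unfolding ws_def .
  have ws_c: "ws ! i \<in> carrier_vec n" if "i < n" for i using ws that by auto
  have sp: "ws ! i \<bullet>c ws ! j = (\<Sum>k<n. ws ! i $ k * cnj (ws ! j $ k))" if "i < n" "j < n" for i j
    using ws_c[OF that(1)] ws_c[OF that(2)]
    by (auto simp: scalar_prod_def atLeast0LessThan conjugate_complex_def intro!: sum.cong)
  define r where "r i = (\<Sum>k<n. (norm (ws ! i $ k))\<^sup>2)" for i
  have r: "ws ! i \<bullet>c ws ! i = complex_of_real (r i)" if "i < n" for i
    unfolding sp[OF that that] r_def by (simp only: of_real_sum complex_norm_square)
  have r0: "r i > 0" if "i < n" for i
  proof -
    have "ws ! i \<bullet>c ws ! i \<noteq> 0" using corthogonalD[OF ws(2), of i i] that ws(3) by simp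
    hence "r i \<noteq> 0" using r[OF that] by simp
    moreover have "r i \<ge> 0" unfolding r_def by (intro sum_nonneg) simp
    ultimately show ?thesis by simp
  qed
  define U where "U = mat n n (\<lambda>(k, i). ws ! i $ k / complex_of_real (sqrt (r i)))"
  have U: "U \<in> carrier_mat n n" unfolding U_def by simp
  have "mat_adjoint U * U = 1\<^sub>m n"
  proof (rule eq_matI)
    fix i j assume "i < dim_row (1\<^sub>m n :: complex mat)" "j < dim_col (1\<^sub>m n :: complex mat)"
    hence ij: "i < n" "j < n" by auto
    have "(mat_adjoint U * U) $$ (i, j) = (\<Sum>k<n. cnj (U $$ (k, i)) * U $$ (k, j))"
      using ij by (simp add: index_mult_sum[OF mat_adjoint_carrier[OF U] U] index_mat_adjoint[OF U] del: index_mult_mat)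
    also have "\<dots> = (\<Sum>k<n. ws ! j $ k * cnj (ws ! i $ k)) / (complex_of_real (sqrt (r i)) * complex_of_real (sqrt (r j)))"
      unfolding sum_divide_distrib using ij by (intro sum.cong refl) (simp add: U_def mult_ac)
    also have "\<dots> = (ws ! j \<bullet>c ws ! i) / (complex_of_real (sqrt (r i)) * complex_of_real (sqrt (r j)))"
      using ij by (simp add: sp)
    also have "\<dots> = 1\<^sub>m n $$ (i, j)"
    proof (cases "i = j")
      case True
      have "complex_of_real (sqrt (r i)) * complex_of_real (sqrt (r i)) = complex_of_real (r i)"
        using r0[OF ij(1)] by (simp flip: of_real_mult)
      thus ?thesis using True ij r[OF ij(1)] r0[OF ij(1)] by simp
    next
      case False
      thus ?thesis using ij corthogonalD[OF ws(2), of j i] ws(3) by simp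
    qed
    finally show "(mat_adjoint U * U) $$ (i, j) = 1\<^sub>m n $$ (i, j)" .
  qed (use mat_adjoint_carrier[OF U] U in auto)
  moreover have "(A * U) $$ (i, 0) = e * U $$ (i, 0)" if i: "i < n" for i
  proof -
    have ws0: "ws ! 0 = v" using hdws ws(3) n by (metis hd_conv_nth length_greater_0_conv)
    have "(A * U) $$ (i, 0) = (\<Sum>k<n. A $$ (i, k) * v $ k) / complex_of_real (sqrt (r 0))"
      unfolding index_mult_sum[OF A U i n] sum_divide_distrib
      using n by (intro sum.cong refl) (simp add: U_def ws0)
    also have "(\<Sum>k<n. A $$ (i, k) * v $ k) = (A *\<^sub>v v) $ i"
      using A v i by (auto simp: scalar_prod_def atLeast0LessThan intro!: sum.cong)
    also have "\<dots> = e * v $ i" using Av v i by simp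
    finally show ?thesis using n i by (simp add: U_def ws0)
  qed
  ultimately show ?thesis using that U by blast
qed

text \<open>
  In the basis that starts with an eigenvector, the first column of the Hermitian matrix is a multiple
  of the first unit vector, and by symmetry so is the first row, with a real diagonal entry. The
  remaining block is Hermitian again and is diagonalized by induction.
\<close>
theorem hermitian_diagonalization:
  fixes A :: "complex mat"
  assumes "A \<in> carrier_mat n n" "mat_adjoint A = A"
  shows "\<exists>U d. U \<in> carrier_mat n n \<and> mat_adjoint U * U = 1\<^sub>m n \<and> A = U * real_diag n d * mat_adjoint U"
  using assms
proof (induction n arbitrary: A)
  case 0
  show ?case
    by (intro exI[of _ "1\<^sub>m 0"] exI[of _ "\<lambda>_. 0"]) (use 0 mat_adjoint_carrier[of "1\<^sub>m 0 :: complex mat" 0 0] in auto)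
next
  case (Suc m)
  note A = Suc.prems(1)
  obtain U e where U: "U \<in> carrier_mat (Suc m) (Suc m)" and UU: "mat_adjoint U * U = 1\<^sub>m (Suc m)"
    and ev: "\<And>i. i < Suc m \<Longrightarrow> (A * U) $$ (i, 0) = e * U $$ (i, 0)"
    using unitary_extending_eigenvector[OF A] by blast
  have U': "mat_adjoint U \<in> carrier_mat (Suc m) (Suc m)" by (rule mat_adjoint_carrier[OF U])
  have UU': "U * mat_adjoint U = 1\<^sub>m (Suc m)" by (rule mat_mult_left_right_inverse[OF U' U UU])
  have AU: "A * U \<in> carrier_mat (Suc m) (Suc m)" using A U by simp
  define B where "B = mat_adjoint U * (A * U)"
  have B: "B \<in> carrier_mat (Suc m) (Suc m)" unfolding B_def using U' AU by simp
  have "mat_adjoint B = mat_adjoint (A * U) * mat_adjoint (mat_adjoint U)"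
    unfolding B_def by (rule mat_adjoint_mult[OF U' AU])
  also have "\<dots> = mat_adjoint U * A * U"
    by (simp add: mat_adjoint_mult[OF A U] Suc.prems(2) mat_adjoint_adjoint[OF U])
  also have "\<dots> = B" unfolding B_def by (rule assoc_mult_mat[OF U' A U])
  finally have BB: "mat_adjoint B = B" .
  have sym: "cnj (B $$ (j, i)) = B $$ (i, j)" if "i < Suc m" "j < Suc m" for i j
    using index_mat_adjoint[OF B that] by (simp add: BB)
  have col0: "B $$ (i, 0) = (if i = 0 then e else 0)" if i: "i < Suc m" for i
  proof -
    have "B $$ (i, 0) = (\<Sum>k<Suc m. mat_adjoint U $$ (i, k) * (e * U $$ (k, 0)))"
      unfolding B_def index_mult_sum[OF U' AU i zero_less_Suc]
      by (intro sum.cong refl) (simp add: ev del: index_mult_mat)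
    also have "\<dots> = e * (\<Sum>k<Suc m. mat_adjoint U $$ (i, k) * U $$ (k, 0))"
      by (simp only: sum_distrib_left mult_ac)
    also have "(\<Sum>k<Suc m. mat_adjoint U $$ (i, k) * U $$ (k, 0)) = 1\<^sub>m (Suc m) $$ (i, 0)"
      using index_mult_sum[OF U' U i zero_less_Suc] UU by simp
    finally show ?thesis using i by simp
  qed
  have row0: "B $$ (0, i) = (if i = 0 then e else 0)" if i: "i < Suc m" for i
    using sym[OF zero_less_Suc i] col0[OF i] sym[of 0 0] col0[of 0] by (auto split: if_splits)
  have e: "e = complex_of_real (Re e)" using sym[of 0 0] col0[of 0]
    by (simp add: complex_eq_iff)
  define C where "C = mat m m (\<lambda>(i, j). B $$ (Suc i, Suc j))"
  have C: "C \<in> carrier_mat m m" unfolding C_def by simp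
  have C_index: "C $$ (i, j) = B $$ (Suc i, Suc j)" if "i < m" "j < m" for i j
    using that by (simp add: C_def)
  have "mat_adjoint C = C"
    by (rule eq_matI) (use C mat_adjoint_carrier[OF C] in \<open>auto simp: index_mat_adjoint[OF C] C_index sym\<close>)
  from Suc.IH[OF C this] obtain V d where V: "V \<in> carrier_mat m m"
    and VV: "mat_adjoint V * V = 1\<^sub>m m" and CV: "C = V * real_diag m d * mat_adjoint V" by blast
  define W where "W = mat (Suc m) (Suc m) (\<lambda>(i, j). case i of 0 \<Rightarrow> (case j of 0 \<Rightarrow> 1 | Suc _ \<Rightarrow> 0)
      | Suc i' \<Rightarrow> (case j of 0 \<Rightarrow> 0 | Suc j' \<Rightarrow> V $$ (i', j')))"
  have W: "W \<in> carrier_mat (Suc m) (Suc m)" unfolding W_def by simp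
  define d' where "d' = case_nat (Re e) d"
  have WW: "mat_adjoint W * W = 1\<^sub>m (Suc m)"
  proof (rule eq_matI)
    fix i j assume "i < dim_row (1\<^sub>m (Suc m) :: complex mat)" "j < dim_col (1\<^sub>m (Suc m) :: complex mat)"
    hence ij: "i < Suc m" "j < Suc m" by auto
    have VVs: "(\<Sum>k<m. cnj (V $$ (k, i')) * V $$ (k, j')) = (if i' = j' then 1 else 0)"
      if "i' < m" "j' < m" for i' j'
      using index_mult_sum[OF mat_adjoint_carrier[OF V] V that] that by (simp add: VV index_mat_adjoint[OF V])
    have "(mat_adjoint W * W) $$ (i, j) = (\<Sum>k<Suc m. cnj (W $$ (k, i)) * W $$ (k, j))"
      using ij by (simp add: index_mult_sum[OF mat_adjoint_carrier[OF W] W] index_mat_adjoint[OF W] del: index_mult_mat sum.lessThan_Suc)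
    also have "\<dots> = 1\<^sub>m (Suc m) $$ (i, j)"
      unfolding sum.lessThan_Suc_shift using ij
      by (cases i; cases j) (simp_all add: W_def VVs)
    finally show "(mat_adjoint W * W) $$ (i, j) = 1\<^sub>m (Suc m) $$ (i, j)" .
  qed (use mat_adjoint_carrier[OF W] W in auto)
  have BW: "B = W * real_diag (Suc m) d' * mat_adjoint W"
  proof (rule eq_matI)
    fix i j assume "i < dim_row (W * real_diag (Suc m) d' * mat_adjoint W)"
      "j < dim_col (W * real_diag (Suc m) d' * mat_adjoint W)"
    hence ij: "i < Suc m" "j < Suc m" using W mat_adjoint_carrier[OF W] by auto
    have Cs: "B $$ (Suc i', Suc j') = (\<Sum>k<m. V $$ (i', k) * complex_of_real (d k) * cnj (V $$ (j', k)))"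
      if "i' < m" "j' < m" for i' j'
      using index_conj_diag[OF V that, of d] that by (simp add: CV[symmetric] C_def)
    show "B $$ (i, j) = (W * real_diag (Suc m) d' * mat_adjoint W) $$ (i, j)"
      unfolding index_conj_diag[OF W ij] sum.lessThan_Suc_shift using ij
      by (cases i; cases j) (simp_all add: W_def d'_def Cs col0 row0 e[symmetric])
  qed (use B W mat_adjoint_carrier[OF W] in auto)
  have W': "mat_adjoint W \<in> carrier_mat (Suc m) (Suc m)" by (rule mat_adjoint_carrier[OF W])
  have UW: "U * W \<in> carrier_mat (Suc m) (Suc m)" using U W by simp
  have adjUW: "mat_adjoint (U * W) = mat_adjoint W * mat_adjoint U" by (rule mat_adjoint_mult[OF U W])
  let ?D = "real_diag (Suc m) d'"
  have D: "?D \<in> carrier_mat (Suc m) (Suc m)" by simp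
  have "mat_adjoint (U * W) * (U * W) = mat_adjoint W * (mat_adjoint U * (U * W))"
    unfolding adjUW by (rule assoc_mult_mat[OF W' U' UW])
  also have "mat_adjoint U * (U * W) = W"
    using assoc_mult_mat[OF U' U W] UU W by simp
  finally have 1: "mat_adjoint (U * W) * (U * W) = 1\<^sub>m (Suc m)" by (simp add: WW)
  have "U * (B * mat_adjoint U) = U * (mat_adjoint U * (A * U * mat_adjoint U))"
    unfolding B_def using assoc_mult_mat[OF U' AU U'] by simp
  also have "\<dots> = (U * mat_adjoint U) * (A * U * mat_adjoint U)"
    using assoc_mult_mat[OF U U' mult_carrier_mat[OF AU U']] by simp
  also have "\<dots> = A * (U * mat_adjoint U)"
    using assoc_mult_mat[OF A U U'] UU' A by simp
  also have "\<dots> = A" using UU' A by simp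
  finally have "A = U * (B * mat_adjoint U)" by simp
  also have "B * mat_adjoint U = W * ?D * (mat_adjoint W * mat_adjoint U)"
    unfolding BW by (rule assoc_mult_mat[OF mult_carrier_mat[OF W D] W' U'])
  also have "U * \<dots> = U * (W * ?D) * mat_adjoint (U * W)"
    unfolding adjUW by (rule assoc_mult_mat[OF U mult_carrier_mat[OF W D] mult_carrier_mat[OF W' U'], symmetric])
  also have "U * (W * ?D) = (U * W) * ?D" by (rule assoc_mult_mat[OF U W D, symmetric])
  finally have "A = (U * W) * ?D * mat_adjoint (U * W)" .
  with 1 UW show ?case by blast
qed

text \<open>
  Padding the equations with zero rows to a square matrix makes the determinant vanish.
\<close>
lemma underdetermined_system_nontrivial:
  fixes rs :: "(nat \<Rightarrow> 'a::field) list"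
  assumes "length rs < n"
  obtains a where "\<exists>k<n. a k \<noteq> 0" "\<And>r. r \<in> set rs \<Longrightarrow> (\<Sum>k<n. r k * a k) = 0"
proof -
  define M where "M = mat n n (\<lambda>(i, k). if i < length rs then (rs ! i) k else 0)"
  have M: "M \<in> carrier_mat n n" unfolding M_def by simp
  have "transpose_mat M *\<^sub>v unit_vec n (n - 1) = 0\<^sub>v n"
    using assms by (intro eq_vecI) (auto simp: M_def scalar_prod_def unit_vec_def intro!: sum.neutral)
  moreover have "unit_vec n (n - 1) \<noteq> (0\<^sub>v n :: 'a vec)"
  proof
    assume "unit_vec n (n - 1) = (0\<^sub>v n :: 'a vec)"
    hence "unit_vec n (n - 1) $ (n - 1) = (0\<^sub>v n :: 'a vec) $ (n - 1)" by simp
    thus False using assms by simp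
  qed
  ultimately have "det (transpose_mat M) = 0"
    using det_0_iff_vec_prod_zero_field[of "transpose_mat M" n] M by (auto intro!: exI[of _ "unit_vec n (n - 1)"])
  hence "det M = 0" using det_transpose[OF M] by simp
  then obtain v where v: "v \<in> carrier_vec n" "v \<noteq> 0\<^sub>v n" and Mv: "M *\<^sub>v v = 0\<^sub>v n"
    using det_0_iff_vec_prod_zero_field[OF M] by blast
  show ?thesis
  proof (rule that[of "\<lambda>k. v $ k"])
    show "\<exists>k<n. v $ k \<noteq> 0" using v by (metis carrier_vecD eq_vecI index_zero_vec)
    fix r assume "r \<in> set rs"
    then obtain i where i: "i < length rs" "r = rs ! i" by (metis in_set_conv_nth)
    have "(M *\<^sub>v v) $ i = (\<Sum>k<n. r k * v $ k)"
      using v i assms by (auto simp: M_def scalar_prod_def atLeast0LessThan intro!: sum.cong)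
    thus "(\<Sum>k<n. r k * v $ k) = 0" using Mv i assms by simp
  qed
qed

text \<open>
  One half of the Courant--Fischer principle. If fewer than \<open>card J\<close> eigenvalues were at least
  \<open>\<beta>\<close>, the eigenvectors with smaller eigenvalues would span a space of dimension greater than
  \<open>n - card J\<close>, and some nonzero vector in it would be supported on \<open>J\<close>. Its quadratic form
  would be both at least and less than \<open>\<beta>\<close> times its squared norm.
\<close>
lemma card_le_eigenvalues_above:
  fixes A :: "complex mat"
  assumes A: "A \<in> carrier_mat n n" and herm: "mat_adjoint A = A" and J: "J \<subseteq> {..<n}"
    and form: "\<And>c. (\<And>i. i \<notin> J \<Longrightarrow> c i = 0) \<Longrightarrow>
      \<beta> * (\<Sum>i<n. (norm (c i))\<^sup>2) \<le> Re (\<Sum>i<n. \<Sum>j<n. cnj (c i) * A $$ (i, j) * c j)"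
  shows "card J \<le> size {#e \<in># proots (char_poly A). \<beta> \<le> Re e#}"
proof -
  obtain U d where U: "U \<in> carrier_mat n n" and UU: "mat_adjoint U * U = 1\<^sub>m n"
    and AU: "A = U * real_diag n d * mat_adjoint U"
    using hermitian_diagonalization[OF A herm] by blast
  have U': "mat_adjoint U \<in> carrier_mat n n" by (rule mat_adjoint_carrier[OF U])
  have "similar_mat_wit A (real_diag n d) U (mat_adjoint U)"
    by (rule similar_mat_witI[OF mat_mult_left_right_inverse[OF U' U UU] UU AU A real_diag_carrier U U'])
  hence "char_poly A = char_poly (real_diag n d)"
    by (intro char_poly_similar) (auto simp: similar_mat_def)
  also have "\<dots> = (\<Prod>a\<leftarrow>diag_mat (real_diag n d). [:- a, 1:])"
    by (rule char_poly_upper_triangular) (auto simp: real_diag_def upper_triangular_def)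
  also have "diag_mat (real_diag n d) = map (\<lambda>i. complex_of_real (d i)) [0..<n]"
    by (auto simp: diag_mat_def real_diag_def)
  finally have "char_poly A = (\<Prod>p\<leftarrow>map (\<lambda>i. [:- complex_of_real (d i), 1:]) [0..<n]. p)"
    by (simp add: o_def)
  hence "proots (char_poly A) = proots (\<Prod>p\<leftarrow>map (\<lambda>i. [:- complex_of_real (d i), 1:]) [0..<n]. p)"
    by (rule arg_cong)
  also have "\<dots> = (\<Sum>p\<leftarrow>map (\<lambda>i. [:- complex_of_real (d i), 1:]) [0..<n]. proots p)"
    by (rule proots_prod_list) auto
  also have "\<dots> = (\<Sum>i\<leftarrow>[0..<n]. {#complex_of_real (d i)#})"
    by (simp add: o_def)
  also have "\<dots> = image_mset (\<lambda>i. complex_of_real (d i)) (mset [0..<n])"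
    by (induction n) auto
  finally have "size {#e \<in># proots (char_poly A). \<beta> \<le> Re e#}
      = size (filter_mset (\<lambda>i. \<beta> \<le> d i) (mset [0..<n]))"
    by (simp add: filter_mset_image_mset)
  also have "\<dots> = length (filter (\<lambda>i. \<beta> \<le> d i) [0..<n])"
    by (simp only: mset_filter[symmetric] size_mset)
  also have "\<dots> = card {i. i < n \<and> \<beta> \<le> d i}"
    unfolding length_filter_conv_card by (rule arg_cong[of _ _ card]) auto
  finally have size: "size {#e \<in># proots (char_poly A). \<beta> \<le> Re e#} = card {i. i < n \<and> \<beta> \<le> d i}" .
  show ?thesis
  proof (rule ccontr)
    define L where "L = {i. i < n \<and> \<beta> \<le> d i}"
    define u where "u i k = U $$ (i, k)" for i k
    assume "\<not> card J \<le> size {#e \<in># proots (char_poly A). \<beta> \<le> Re e#}"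
    hence less: "card L < card J" by (simp add: size L_def)
    have finJ: "finite J" using J finite_subset by blast
    obtain Ls where Ls: "set Ls = L" "length Ls = card L"
      using finite_distinct_list[of L] distinct_card unfolding L_def by (metis finite_Collect_conjI finite_Collect_less_nat)
    obtain Js where Js: "set Js = {..<n} - J" "length Js = n - card J"
      using finite_distinct_list[of "{..<n} - J"] distinct_card card_Diff_subset[OF finJ J]
      by (metis card_lessThan finite_Diff finite_lessThan)
    (* A vector with coordinates a in the eigenbasis is supported on J iff the first group of equations
       holds; the second group excludes the eigenvectors with eigenvalue at least \<beta>. *)
    define rs where "rs = map u Js @ map (\<lambda>l k. if k = l then 1 else 0) Ls"
    have "card J \<le> n" using card_mono[OF _ J] by simp
    hence "length rs < n" using less by (simp add: rs_def Ls Js)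
    then obtain a where a0: "\<exists>k<n. a k \<noteq> 0" and ars: "\<And>r. r \<in> set rs \<Longrightarrow> (\<Sum>k<n. r k * a k) = 0"
      using underdetermined_system_nontrivial[of rs n] by metis
    have aL: "a k = 0" if "k < n" "\<beta> \<le> d k" for k
    proof -
      have "(\<lambda>l. if l = k then 1 else 0) \<in> set rs" using that by (auto simp: rs_def Ls L_def)
      from ars[OF this] that show ?thesis by (simp add: if_distrib[of "\<lambda>x. x * _"] cong: if_cong)
    qed
    define c where "c i = (if i < n then \<Sum>k<n. u i k * a k else 0)" for i
    have cJ: "c i = 0" if "i \<notin> J" for i
      using ars[of "u i"] that by (auto simp: c_def rs_def Js)
    have orth: "(\<Sum>i<n. cnj (u i k) * u i l) = (if k = l then 1 else 0)" if "k < n" "l < n" for k l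
      using index_mult_sum[OF U' U that] that by (simp add: UU u_def index_mat_adjoint[OF U])
    have ca: "(\<Sum>i<n. cnj (u i k) * c i) = a k" if k: "k < n" for k
    proof -
      have "(\<Sum>i<n. cnj (u i k) * c i) = (\<Sum>i<n. \<Sum>l<n. cnj (u i k) * u i l * a l)"
        by (simp add: c_def sum_distrib_left mult.assoc)
      also have "\<dots> = (\<Sum>l<n. (\<Sum>i<n. cnj (u i k) * u i l) * a l)"
        unfolding sum_distrib_right by (rule sum.swap)
      also have "\<dots> = (\<Sum>l<n. if k = l then a k else 0)"
        using k by (intro sum.cong refl) (auto simp: orth)
      finally show ?thesis using k by simp
    qed
    have "complex_of_real (\<Sum>i<n. (norm (c i))\<^sup>2) = (\<Sum>i<n. cnj (c i) * c i)"
      unfolding of_real_sum complex_norm_square by (simp only: mult.commute)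
    also have "\<dots> = (\<Sum>i<n. \<Sum>k<n. cnj (a k) * (cnj (u i k) * c i))"
    proof (intro sum.cong refl)
      fix i assume "i \<in> {..<n}"
      hence "cnj (c i) = (\<Sum>k<n. cnj (a k) * cnj (u i k))" by (simp add: c_def mult.commute)
      thus "cnj (c i) * c i = (\<Sum>k<n. cnj (a k) * (cnj (u i k) * c i))"
        by (simp only: sum_distrib_right mult.assoc)
    qed
    also have "\<dots> = (\<Sum>k<n. cnj (a k) * (\<Sum>i<n. cnj (u i k) * c i))"
      unfolding sum_distrib_left by (rule sum.swap)
    also have "\<dots> = (\<Sum>k<n. cnj (a k) * a k)" by (simp add: ca)
    also have "\<dots> = complex_of_real (\<Sum>k<n. (norm (a k))\<^sup>2)"
      unfolding of_real_sum complex_norm_square by (simp only: mult.commute)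
    finally have parseval: "(\<Sum>i<n. (norm (c i))\<^sup>2) = (\<Sum>k<n. (norm (a k))\<^sup>2)"
      by (simp only: of_real_eq_iff)
    have "(\<Sum>i<n. \<Sum>j<n. cnj (c i) * A $$ (i, j) * c j)
        = (\<Sum>i<n. \<Sum>j<n. \<Sum>k<n. complex_of_real (d k) * ((cnj (c i) * u i k) * (cnj (u j k) * c j)))"
      unfolding AU by (intro sum.cong refl)
        (simp add: index_conj_diag[OF U] sum_distrib_left sum_distrib_right u_def mult_ac del: index_mult_mat)
    also have "\<dots> = (\<Sum>i<n. \<Sum>k<n. \<Sum>j<n. complex_of_real (d k) * ((cnj (c i) * u i k) * (cnj (u j k) * c j)))"
      by (intro sum.cong refl sum.swap)
    also have "\<dots> = (\<Sum>k<n. \<Sum>i<n. \<Sum>j<n. complex_of_real (d k) * ((cnj (c i) * u i k) * (cnj (u j k) * c j)))"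
      by (rule sum.swap)
    also have "\<dots> = (\<Sum>k<n. complex_of_real (d k) * ((\<Sum>i<n. cnj (c i) * u i k) * (\<Sum>j<n. cnj (u j k) * c j)))"
      by (simp only: sum_product) (simp only: sum_distrib_left)
    also have "\<dots> = (\<Sum>k<n. complex_of_real (d k) * (cnj (a k) * a k))"
    proof (intro sum.cong refl)
      fix k assume k: "k \<in> {..<n}"
      have "(\<Sum>i<n. cnj (c i) * u i k) = cnj (\<Sum>i<n. cnj (u i k) * c i)" by (simp add: mult.commute)
      also have "\<dots> = cnj (a k)" using k by (simp only: ca lessThan_iff)
      finally show "complex_of_real (d k) * ((\<Sum>i<n. cnj (c i) * u i k) * (\<Sum>j<n. cnj (u j k) * c j))
          = complex_of_real (d k) * (cnj (a k) * a k)" using k by (simp only: ca lessThan_iff)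
    qed
    also have "\<dots> = complex_of_real (\<Sum>k<n. d k * (norm (a k))\<^sup>2)"
      unfolding of_real_sum of_real_mult complex_norm_square by (simp only: mult_ac)
    finally have form_c: "(\<Sum>i<n. \<Sum>j<n. cnj (c i) * A $$ (i, j) * c j) = \<dots>" .
    have "\<beta> * (\<Sum>k<n. (norm (a k))\<^sup>2) \<le> (\<Sum>k<n. d k * (norm (a k))\<^sup>2)"
      using form[of c, OF cJ, unfolded form_c parseval Re_complex_of_real] .
    moreover have "(\<Sum>k<n. d k * (norm (a k))\<^sup>2) < (\<Sum>k<n. \<beta> * (norm (a k))\<^sup>2)"
    proof (rule sum_strict_mono_ex1)
      show "\<forall>k\<in>{..<n}. d k * (norm (a k))\<^sup>2 \<le> \<beta> * (norm (a k))\<^sup>2"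
        using aL by (metis lessThan_iff linear mult_right_mono mult_zero_right norm_zero power_zero_numeral zero_le_power2 order_refl)
      obtain k where k: "k < n" "a k \<noteq> 0" using a0 by blast
      hence "d k < \<beta>" using aL by force
      thus "\<exists>k\<in>{..<n}. d k * (norm (a k))\<^sup>2 < \<beta> * (norm (a k))\<^sup>2" using k by (intro bexI[of _ k]) auto
    qed simp
    ultimately show False by (simp add: sum_distrib_left)
  qed
qed

lemma gram_hermitian:
  fixes A :: "complex mat"
  assumes "A \<in> carrier_mat m n"
  shows "mat_adjoint (mat_adjoint A * A) = mat_adjoint A * A"
  using mat_adjoint_mult[OF mat_adjoint_carrier[OF assms] assms] mat_adjoint_adjoint[OF assms] by simp

lemma card_le_singular_values_above:
  fixes A :: "complex mat"
  assumes A: "A \<in> carrier_mat m n" and nm: "n \<le> m" and J: "J \<subseteq> {..<n}"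
    and form: "\<And>c. (\<And>i. i \<notin> J \<Longrightarrow> c i = 0) \<Longrightarrow>
      b\<^sup>2 * (\<Sum>i<n. (norm (c i))\<^sup>2) \<le> (\<Sum>k<m. (norm (\<Sum>j<n. A $$ (k, j) * c j))\<^sup>2)"
  shows "card J \<le> size {#\<sigma> \<in># singular_values A. b \<le> \<sigma>#}"
proof -
  let ?G = "mat_adjoint A * A"
  have A': "mat_adjoint A \<in> carrier_mat n m" by (rule mat_adjoint_carrier[OF A])
  have G: "?G \<in> carrier_mat n n" using A A' by simp
  have "card J \<le> size {#e \<in># proots (char_poly ?G). b\<^sup>2 \<le> Re e#}"
  proof (rule card_le_eigenvalues_above[OF G gram_hermitian[OF A] J])
    fix c assume c: "\<And>i. i \<notin> J \<Longrightarrow> c i = (0::complex)"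
    have "(\<Sum>i<n. \<Sum>j<n. cnj (c i) * ?G $$ (i, j) * c j)
        = (\<Sum>i<n. \<Sum>j<n. \<Sum>k<m. cnj (A $$ (k, i) * c i) * (A $$ (k, j) * c j))"
      by (intro sum.cong refl)
        (simp add: index_mult_sum[OF A' A] index_mat_adjoint[OF A] sum_distrib_left sum_distrib_right mult_ac del: index_mult_mat)
    also have "\<dots> = (\<Sum>i<n. \<Sum>k<m. \<Sum>j<n. cnj (A $$ (k, i) * c i) * (A $$ (k, j) * c j))"
      by (intro sum.cong refl sum.swap)
    also have "\<dots> = (\<Sum>k<m. \<Sum>i<n. \<Sum>j<n. cnj (A $$ (k, i) * c i) * (A $$ (k, j) * c j))"
      by (rule sum.swap)
    also have "\<dots> = (\<Sum>k<m. cnj (\<Sum>j<n. A $$ (k, j) * c j) * (\<Sum>j<n. A $$ (k, j) * c j))"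
      unfolding cnj_sum sum_product ..
    also have "\<dots> = complex_of_real (\<Sum>k<m. (norm (\<Sum>j<n. A $$ (k, j) * c j))\<^sup>2)"
      unfolding of_real_sum complex_norm_square by (simp only: mult.commute)
    finally show "b\<^sup>2 * (\<Sum>i<n. (norm (c i))\<^sup>2) \<le> Re (\<Sum>i<n. \<Sum>j<n. cnj (c i) * ?G $$ (i, j) * c j)"
      using form[OF c] by simp
  qed
  also have "\<dots> \<le> size {#e \<in># proots (char_poly ?G). b \<le> sqrt (Re e)#}"
    by (intro size_mset_mono mset_subset_eqI) (auto intro: real_le_rsqrt)
  also have "\<dots> = size {#\<sigma> \<in># singular_values A. b \<le> \<sigma>#}"
    using A nm by (simp add: singular_values_def filter_mset_image_mset)
  finally show ?thesis .
qed

lemma size_singular_values: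
  assumes A: "A \<in> carrier_mat m n" and nm: "n \<le> m"
  shows "size (singular_values A) = n"
proof -
  have "mat_adjoint A * A \<in> carrier_mat n n" using A mat_adjoint_carrier[OF A] by simp
  from degree_monic_char_poly[OF this] show ?thesis
    using A nm by (simp add: singular_values_def size_proots_complex)
qed

section \<open>From counts to groups\<close>

text \<open>
  The values are sorted in decreasing order and cut into consecutive blocks of lengths \<open>q 1, q 2, \<dots>\<close>.
  The first \<open>q 1 + \<dots> + q m\<close> values are all at least \<open>b m\<close>, because at least that many values are.
\<close>

lemma grouped_lower_bounds_by_counting:
  assumes size: "size sv = (\<Sum>m=1..l. q m)"
    and count: "\<And>m. m \<in> {1..l} \<Longrightarrow> (\<Sum>i=1..m. q i) \<le> size {#\<sigma> \<in># sv. b m \<le> \<sigma>#}"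
  shows "grouped_lower_bounds l q b sv"
proof -
  define xs where "xs = rev (sorted_list_of_multiset sv)"
  define Q where "Q m = (\<Sum>i=1..m. q i)" for m
  define S where "S m = mset (take (q m) (drop (Q (m - 1)) xs))" for m
  have xs: "mset xs = sv" by (simp add: xs_def)
  have desc: "xs ! j \<le> xs ! i" if "i \<le> j" "j < length xs" for i j
    using that sorted_rev_nth_mono[of xs i j] unfolding xs_def by simp
  have len: "length xs = Q l" unfolding Q_def size[symmetric] xs[symmetric] by simp
  have Q_Suc: "Q (Suc m) = Q m + q (Suc m)" for m unfolding Q_def by simp
  have prefix: "mset (take (Q m) xs) = (\<Sum>i=1..m. S i)" for m
  proof (induction m)
    case 0
    show ?case by (simp add: Q_def)
  next
    case (Suc m)
    have "mset (take (Q (Suc m)) xs) = mset (take (Q m) xs) + S (Suc m)"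
      by (simp add: Q_Suc take_add S_def)
    thus ?case using Suc by simp
  qed
  have above: "b m \<le> xs ! n" if m: "m \<in> {1..l}" and n: "n < Q m" "n < length xs" for m n
  proof (rule ccontr)
    assume less: "\<not> b m \<le> xs ! n"
    have "filter (\<lambda>\<sigma>. b m \<le> \<sigma>) (drop n xs) = []"
    proof (rule filter_False, rule ballI)
      fix x assume "x \<in> set (drop n xs)"
      then obtain i where "i < length xs - n" "x = xs ! (n + i)" by (auto simp: in_set_conv_nth)
      moreover from this have "n + i < length xs" by simp
      ultimately show "\<not> b m \<le> x" using desc[of n "n + i"] less by simp
    qed
    hence "filter (\<lambda>\<sigma>. b m \<le> \<sigma>) xs = filter (\<lambda>\<sigma>. b m \<le> \<sigma>) (take n xs)"
      by (metis append_Nil2 append_take_drop_id filter_append)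
    hence "length (filter (\<lambda>\<sigma>. b m \<le> \<sigma>) xs) \<le> n"
      by (metis length_filter_le length_take min.bounded_iff)
    moreover have "size {#\<sigma> \<in># sv. b m \<le> \<sigma>#} = length (filter (\<lambda>\<sigma>. b m \<le> \<sigma>) xs)"
      unfolding xs[symmetric] by (simp only: mset_filter[symmetric] size_mset)
    ultimately show False using count[OF m] n(1) unfolding Q_def by linarith
  qed
  show ?thesis unfolding grouped_lower_bounds_def
  proof (intro exI[of _ S] conjI ballI)
    show "sv = (\<Sum>m=1..l. S m)" using prefix[of l] xs len by simp
    fix m assume m: "m \<in> {1..l}"
    then obtain m' where m': "m = Suc m'" by (cases m) auto
    have "Q m \<le> Q l" unfolding Q_def using m by (intro sum_mono2) auto
    hence Qm: "Q m' + q m \<le> length xs" using Q_Suc[of m'] m' len by simp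
    show "size (S m) = q m" unfolding S_def using Qm by (simp add: m')
    fix \<sigma> assume "\<sigma> \<in># S m"
    then obtain i where "i < q m" "\<sigma> = xs ! (Q m' + i)"
      using Qm by (auto simp: S_def m' in_set_conv_nth)
    thus "b m \<le> \<sigma>" using above[OF m, of "Q m' + i"] Q_Suc[of m'] m' Qm by simp
  qed
qed

text \<open>
  Both sides count the pairs of a cluster \<open>C\<close> and a number \<open>i\<close> with \<open>1 \<le> i \<le> m\<close> and \<open>i \<le> card C\<close>.
\<close>
lemma sum_num_clusters:
  assumes "finite P"
  shows "(\<Sum>i=1..m. num_clusters P i) = (\<Sum>C\<in>P. min m (card C))"
proof -
  have "(\<Sum>i=1..m. num_clusters P i) = (\<Sum>i=1..m. \<Sum>C\<in>P. if i \<le> card C then 1 else 0)"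
    unfolding num_clusters_def using assms by (simp add: sum.If_cases Int_def)
  also have "\<dots> = (\<Sum>C\<in>P. \<Sum>i=1..m. if i \<le> card C then 1 else 0)" by (rule sum.swap)
  also have "\<dots> = (\<Sum>C\<in>P. card {i \<in> {1..m}. i \<le> card C})" by (simp add: sum.If_cases Int_def)
  also have "\<dots> = (\<Sum>C\<in>P. min m (card C))"
  proof (intro sum.cong refl)
    fix C
    have "{i \<in> {1..m}. i \<le> card C} = {1..min m (card C)}" by auto
    thus "card {i \<in> {1..m}. i \<le> card C} = min m (card C)" by simp
  qed
  finally show ?thesis .
qed

section \<open>Multi-cluster configurations\<close>

text \<open>
  The lower bound on \<open>N\<close> makes the cross terms between different clusters at most \<open>1 / (2 * s)\<close>
  times the product of the norms, and there are at most \<open>s\<close> clusters. The upper bound on \<open>N\<close>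
  makes the clusters narrow, both compared with \<open>1 / N\<close>, as the single-cluster bound requires, and, combined
  with the lower bound on \<open>N\<close>, compared with \<open>\<theta>\<close>.
\<close>

lemma clusters_lower_bound:
  fixes c :: "real \<Rightarrow> complex" and T :: "real set \<Rightarrow> real set"
  assumes cfg: "clustered_configuration \<Delta> \<theta> s l \<tau> X"
    and part: "cluster_partition \<Delta> \<theta> l \<tau> X P"
    and adm: "admissible_N (2 * cross_constant l + 1) (1 / 16) \<Delta> \<theta> s \<tau> N"
    and N: "s - 1 \<le> N" and m: "1 \<le> m" "m \<le> l"
    and T: "\<And>C. C \<in> P \<Longrightarrow> T C \<subseteq> C" "\<And>C. C \<in> P \<Longrightarrow> card (T C) \<le> m"
  shows "(real N * (real N * \<Delta> / (32 * pi * exp 1)) ^ (2 * (m - 1))) / 2 * (\<Sum>C\<in>P. \<Sum>x\<in>T C. (norm (c x))\<^sup>2)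
       \<le> (\<Sum>k\<le>N. (norm (\<Sum>C\<in>P. \<Sum>x\<in>T C. c x * cis x ^ k))\<^sup>2)"
proof -
  let ?K = "cross_constant l"
  define u where "u C k = (\<Sum>x\<in>T C. c x * cis x ^ k)" for C k
  define \<rho> where "\<rho> = real N * \<Delta> / (32 * pi * exp 1)"
  have X: "finite X" "card X = s" and D: "\<Delta> > 0" and l: "1 \<le> l" "l \<le> s"
    and \<tau>: "real l - 1 \<le> \<tau>" and \<theta>: "\<theta> > 0"
    using cfg unfolding clustered_configuration_def by blast+
  have P: "partition_on X P" and
    cl: "\<And>C x y. C \<in> P \<Longrightarrow> x \<in> C \<Longrightarrow> y \<in> C \<Longrightarrow> x \<noteq> y \<Longrightarrow> \<Delta> \<le> wrap_dist x y \<and> wrap_dist x y \<le> \<tau> * \<Delta>" and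
    sepP: "\<And>C x y. C \<in> P \<Longrightarrow> x \<in> C \<Longrightarrow> y \<in> X - C \<Longrightarrow> \<theta> \<le> wrap_dist x y"
    using part unfolding cluster_partition_def single_cluster_def by auto
  have finP: "finite P" using P X(1) by (simp add: finite_elements)
  have PX: "\<Union>P = X" and disj: "disjoint P" and "{} \<notin> P" using P by (auto simp: partition_on_def)
  have finT: "finite (T C)" if "C \<in> P" for C
    using T(1)[OF that] that PX X(1) by (meson Union_upper finite_subset)
  have cardP: "card P \<le> s"
  proof -
    have "card P \<le> (\<Sum>C\<in>P. card C)"
      unfolding card_eq_sum using finP PX X(1) \<open>{} \<notin> P\<close>
      by (intro sum_mono) (metis One_nat_def Suc_leI Union_upper card_eq_sum card_gt_0_iff finite_subset)
    also have "\<dots> = card (\<Union>P)"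
    proof (rule card_Union_disjoint[symmetric])
      show "pairwise disjnt P" using disj unfolding disjoint_def pairwise_def disjnt_def by blast
      show "finite C" if "C \<in> P" for C using that PX X(1) by (metis Union_upper finite_subset)
    qed
    finally show ?thesis by (simp add: PX X)
  qed
  have \<tau>0: "\<tau> \<ge> 0" using \<tau> l by simp
  have wrap_le: "wrap_dist x y \<le> \<tau> * \<Delta>" if "C \<in> P" "x \<in> C" "y \<in> C" for C x y
    using cl[OF that] D \<tau>0 by (cases "x = y") auto
  have s: "real s \<ge> 1" using l by simp
  have K: "?K \<ge> 0" unfolding cross_constant_def by simp
  have lower: "(2 * ?K + 1) * real s / \<theta> \<le> real N" and upper: "real N * (real s * \<tau> * \<Delta>) \<le> 1 / 16"
    using adm unfolding admissible_N_def by auto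
  have N0: "real N > 0" using lower K s \<theta> by (smt (verit) divide_pos_pos mult_pos_pos)
  have N\<theta>: "(2 * ?K + 1) * real s \<le> real N * \<theta>" using lower \<theta> by (simp add: divide_le_eq)
  have upper1: "real N * (\<tau> * \<Delta>) \<le> 1 / 16"
  proof -
    have "1 * (real N * (\<tau> * \<Delta>)) \<le> real s * (real N * (\<tau> * \<Delta>))"
      using s \<tau>0 D by (intro mult_right_mono) auto
    thus ?thesis using upper by (simp add: mult_ac)
  qed
  have each: "real N * \<rho> ^ (2 * (m - 1)) * (\<Sum>x\<in>T C. (norm (c x))\<^sup>2) \<le> (\<Sum>k\<le>N. (norm (u C k))\<^sup>2)"
    if C: "C \<in> P" for C
  proof (cases "T C = {}")
    case True
    thus ?thesis by (simp add: sum_nonneg)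
  next
    case False
    then obtain q where q: "card (T C) = Suc q" using finT[OF C] by (metis card_gt_0_iff gr0_implies_Suc)
    have TC: "x \<in> C" if "x \<in> T C" for x using T(1)[OF C] that by blast
    obtain y :: "real \<Rightarrow> real" where y: "\<And>x. cis (y x) = cis x"
      "\<And>x z. x \<in> T C \<Longrightarrow> z \<in> T C \<Longrightarrow> x \<noteq> z \<Longrightarrow> \<Delta> \<le> \<bar>y x - y z\<bar>"
      "\<And>x z. x \<in> T C \<Longrightarrow> z \<in> T C \<Longrightarrow> \<bar>y x - y z\<bar> \<le> 2 * (\<tau> * \<Delta>)"
      by (rule lift_cluster[of "T C" \<Delta> "\<tau> * \<Delta>"]) (use cl[OF C] wrap_le[OF C] TC in auto)
    have "Suc q \<le> s"
      unfolding q[symmetric] X(2)[symmetric] using T(1)[OF C] C PX X(1) by (intro card_mono) auto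
    hence qN: "q \<le> N" using N by simp
    have "real N * \<rho> ^ (2 * q) * (\<Sum>x\<in>T C. (norm (c x))\<^sup>2) \<le> (\<Sum>k\<le>N. (norm (u C k))\<^sup>2)"
      unfolding \<rho>_def u_def
    proof (rule single_cluster_lower_bound[OF finT[OF C] q _ D y(2) _ qN])
      show "cis x = cis (y x)" for x by (simp add: y)
      show "real N * \<bar>y x - y z\<bar> \<le> 1" if "x \<in> T C" "z \<in> T C" for x z
        using mult_left_mono[OF y(3)[OF that], of "real N"] upper1 by simp
    qed
    moreover have "\<rho> ^ (2 * (m - 1)) \<le> \<rho> ^ (2 * q)"
    proof (cases "q = m - 1")
      (* A cluster with fewer than m nodes satisfies a bound with a smaller exponent, which is better
         because the base is at most 1: here l \<ge> 2, so \<tau> \<ge> 1 and N * \<Delta> \<le> N * \<tau> * \<Delta>. *)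
      case False
      hence less: "q < m - 1" using T(2)[OF C] q m by simp
      hence "real l \<ge> 2" using m by simp
      hence "1 * \<Delta> \<le> \<tau> * \<Delta>" using \<tau> D by (intro mult_right_mono) auto
      hence "real N * \<Delta> \<le> real N * (\<tau> * \<Delta>)" by (intro mult_left_mono) auto
      hence "real N * \<Delta> \<le> 1 * 1" using upper1 by simp
      also have "\<dots> \<le> (32 * pi) * exp 1" using pi_ge_two by (intro mult_mono) auto
      finally have "\<rho> \<le> 1" unfolding \<rho>_def by (simp add: divide_le_eq)
      moreover have "\<rho> \<ge> 0" unfolding \<rho>_def using D by simp
      ultimately show ?thesis using less by (intro power_decreasing) auto
    qed simp
    hence "real N * \<rho> ^ (2 * (m - 1)) * (\<Sum>x\<in>T C. (norm (c x))\<^sup>2) \<le> real N * \<rho> ^ (2 * q) * (\<Sum>x\<in>T C. (norm (c x))\<^sup>2)"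
      by (intro mult_right_mono mult_left_mono sum_nonneg) auto
    ultimately show ?thesis by linarith
  qed
  have \<eta>: "4 * pi * (\<tau> * \<Delta>) \<le> \<theta>"
  proof -
    have "real N * (4 * pi * (\<tau> * \<Delta>)) = 4 * pi * (real N * (\<tau> * \<Delta>))" by simp
    also have "\<dots> \<le> 4 * pi * (1 / 16)" by (intro mult_left_mono upper1) auto
    also have "\<dots> \<le> 1" using pi_less_4 by simp
    also have "\<dots> \<le> (2 * ?K + 1) * real s" using K s by (smt (verit) mult_le_cancel_right1 mult_le_cancel_left1)
    also note N\<theta>
    finally show ?thesis using N0 by simp
  qed
  define \<epsilon> where "\<epsilon> = ?K / (real N * \<theta>)"
  have "(\<Sum>C\<in>P. \<Sum>k\<le>N. (norm (u C k))\<^sup>2) / 2 \<le> (\<Sum>k\<le>N. (norm (\<Sum>C\<in>P. u C k))\<^sup>2)"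
  proof (rule almost_orthogonal_sum[OF finP, of \<epsilon>])
    show "0 \<le> \<epsilon>" using K N0 \<theta> by (simp add: \<epsilon>_def)
    have "?K * real (card P) \<le> ?K * real s" using K cardP by (intro mult_left_mono) auto
    also have "\<dots> \<le> 1 / 2 * ((2 * ?K + 1) * real s)" by (simp add: algebra_simps)
    also have "\<dots> \<le> 1 / 2 * (real N * \<theta>)" by (intro mult_left_mono N\<theta>) auto
    finally show "\<epsilon> * real (card P) \<le> 1 / 2" using N0 \<theta> by (simp add: \<epsilon>_def divide_le_eq)
    fix C E assume CE: "C \<in> P" "E \<in> P" "C \<noteq> E"
    have "real N * \<theta> * norm (\<Sum>k\<le>N. u C k * cnj (u E k))
        \<le> ?K * (sqrt (\<Sum>k\<le>N. (norm (u C k))\<^sup>2) * sqrt (\<Sum>k\<le>N. (norm (u E k))\<^sup>2))"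
      unfolding u_def
    proof (rule separated_clusters_almost_orthogonal[OF finT[OF CE(1)] finT[OF CE(2)] _ _ \<theta> _ _ _ \<eta>])
      show "card (T C) \<le> l" "card (T E) \<le> l" using T(2)[OF CE(1)] T(2)[OF CE(2)] m by auto
      show "\<theta> \<le> wrap_dist x z" if "x \<in> T C" "z \<in> T E" for x z
      proof (rule sepP[OF CE(1)])
        have "C \<inter> E = {}" using disj CE by (auto simp: disjoint_def)
        thus "z \<in> X - C" using that(2) T(1)[OF CE(2)] CE(2) PX by blast
      qed (use that T(1)[OF CE(1)] in auto)
      show "wrap_dist x y \<le> \<tau> * \<Delta>" if "x \<in> T C" "y \<in> T C" for x y
        using that T(1)[OF CE(1)] wrap_le[OF CE(1)] by blast
      show "wrap_dist x y \<le> \<tau> * \<Delta>" if "x \<in> T E" "y \<in> T E" for x y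
        using that T(1)[OF CE(2)] wrap_le[OF CE(2)] by blast
    qed
    thus "norm (\<Sum>k\<le>N. u C k * cnj (u E k))
        \<le> \<epsilon> * (sqrt (\<Sum>k\<le>N. (norm (u C k))\<^sup>2) * sqrt (\<Sum>k\<le>N. (norm (u E k))\<^sup>2))"
      using N0 \<theta> by (simp add: \<epsilon>_def le_divide_eq mult_ac)
  qed
  note orthogonal = this
  have "real N * \<rho> ^ (2 * (m - 1)) * (\<Sum>C\<in>P. \<Sum>x\<in>T C. (norm (c x))\<^sup>2) \<le> (\<Sum>C\<in>P. \<Sum>k\<le>N. (norm (u C k))\<^sup>2)"
    unfolding sum_distrib_left[of _ _ P] by (intro sum_mono each)
  hence "real N * \<rho> ^ (2 * (m - 1)) * (\<Sum>C\<in>P. \<Sum>x\<in>T C. (norm (c x))\<^sup>2) / 2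
      \<le> (\<Sum>C\<in>P. \<Sum>k\<le>N. (norm (u C k))\<^sup>2) / 2"
    by (rule divide_right_mono) simp
  also note orthogonal
  finally have "real N * \<rho> ^ (2 * (m - 1)) * (\<Sum>C\<in>P. \<Sum>x\<in>T C. (norm (c x))\<^sup>2) / 2
      \<le> (\<Sum>k\<le>N. (norm (\<Sum>C\<in>P. u C k))\<^sup>2)" .
  thus ?thesis unfolding u_def \<rho>_def by (simp only: times_divide_eq_left)
qed

lemma index_vandermonde:
  "k \<le> N \<Longrightarrow> j < length xs \<Longrightarrow> vandermonde N xs $$ (k, j) = cis (xs ! j) ^ k"
  by (simp add: vandermonde_def cis_conv_exp exp_of_nat_mult[symmetric] mult_ac)

theorem theorem7p2:
  "\<exists>(C\<^sub>4 :: nat \<Rightarrow> real) (C\<^sub>5 :: nat \<Rightarrow> real) (C\<^sub>7 :: real).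
     (\<forall>l\<ge>1. C\<^sub>4 l > 0 \<and> C\<^sub>5 l > 0) \<and> C\<^sub>7 > 0 \<and>
     (\<forall>(\<Delta> :: real) (\<theta> :: real) (s :: nat) (l :: nat) (\<tau> :: real) (N :: nat)
        (xs :: real list) (P :: real set set).
        distinct xs \<and> length xs = s \<and>
        clustered_configuration \<Delta> \<theta> s l \<tau> (set xs) \<and>
        s - 1 \<le> N \<and>
        admissible_N (C\<^sub>4 l) (C\<^sub>5 l) \<Delta> \<theta> s \<tau> N \<and>
        cluster_partition \<Delta> \<theta> l \<tau> (set xs) P \<longrightarrow>
        grouped_lower_bounds l (num_clusters P)
          (\<lambda>m. C\<^sub>7 * sqrt (real N) * (real N * \<Delta> / (32 * pi * exp 1)) ^ (m - 1))
          (singular_values (vandermonde N xs)))"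
(* The first summand of 2 * cross_constant l + 1 keeps the cross terms below 1 / (2 * s); the summand 1,
   with 4 * pi * (1 / 16) \<le> 1, makes the clusters narrow compared with \<theta>. The bound 1 / 16 also puts
   the lifted clusters into intervals of length at most 1 / N. Almost orthogonality halves the squared
   norm, so that any constant up to 1 / sqrt 2 serves as the last witness. *)
proof (rule exI[of _ "\<lambda>l. 2 * cross_constant l + 1"], rule exI[of _ "\<lambda>_. 1 / 16"], rule exI[of _ "1 / 2"],
    intro conjI allI impI)
  fix l :: nat
  show "0 < 2 * cross_constant l + 1" unfolding cross_constant_def by (simp add: add_nonneg_pos)
next
  fix \<Delta> \<theta> :: real and s l :: nat and \<tau> :: real and N :: nat and xs :: "real list" and P :: "real set set"
  assume asm: "distinct xs \<and> length xs = s \<and> clustered_configuration \<Delta> \<theta> s l \<tau> (set xs) \<and> s - 1 \<le> N \<and>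
    admissible_N (2 * cross_constant l + 1) (1 / 16) \<Delta> \<theta> s \<tau> N \<and> cluster_partition \<Delta> \<theta> l \<tau> (set xs) P"
  hence dist: "distinct xs" and len: "length xs = s" and cfg: "clustered_configuration \<Delta> \<theta> s l \<tau> (set xs)"
    and sN: "s - 1 \<le> N" and adm: "admissible_N (2 * cross_constant l + 1) (1 / 16) \<Delta> \<theta> s \<tau> N"
    and part: "cluster_partition \<Delta> \<theta> l \<tau> (set xs) P" by auto
  have l: "1 \<le> l" and D: "\<Delta> > 0" using cfg unfolding clustered_configuration_def by auto
  have pon: "partition_on (set xs) P" and cardC: "\<And>C. C \<in> P \<Longrightarrow> card C \<le> l"
    using part unfolding cluster_partition_def by blast+
  have PX: "\<Union>P = set xs" and disj: "disjoint P" and finP: "finite P"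
    using pon finite_elements[of "set xs" P] by (simp_all add: partition_on_def)
  have finC: "finite C" if "C \<in> P" for C using that PX by (metis List.finite_set Union_upper finite_subset)
  let ?V = "vandermonde N xs"
  have V: "?V \<in> carrier_mat (N + 1) s" by (simp add: vandermonde_def len)
  have sN': "s \<le> N + 1" using sN by simp
  have inj: "inj_on (nth xs) {..<s}" using dist len by (auto simp: inj_on_def nth_eq_iff_index_eq)
  have img: "nth xs ` {..<s} = set xs" using len by (auto simp: set_conv_nth)
  have card_Un: "card (\<Union>C\<in>P. T C) = (\<Sum>C\<in>P. card (T C))" if "\<And>C. C \<in> P \<Longrightarrow> T C \<subseteq> C" for T :: "real set \<Rightarrow> real set"
  proof (rule card_UN_disjoint[OF finP])
    show "\<forall>C\<in>P. finite (T C)" using that finC by (meson finite_subset)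
    show "\<forall>C\<in>P. \<forall>E\<in>P. C \<noteq> E \<longrightarrow> T C \<inter> T E = {}"
    proof (intro ballI impI)
      fix C E assume "C \<in> P" "E \<in> P" "C \<noteq> E"
      thus "T C \<inter> T E = {}" using disj that[of C] that[of E] unfolding disjoint_def by blast
    qed
  qed
  show "grouped_lower_bounds l (num_clusters P)
     (\<lambda>m. 1 / 2 * sqrt (real N) * (real N * \<Delta> / (32 * pi * exp 1)) ^ (m - 1)) (singular_values ?V)"
  proof (rule grouped_lower_bounds_by_counting)
    have "(\<Sum>m=1..l. num_clusters P m) = (\<Sum>C\<in>P. card C)"
      unfolding sum_num_clusters[OF finP] using cardC by (intro sum.cong) auto
    also have "\<dots> = card (\<Union>P)" using card_Un[of "\<lambda>C. C"] by simp
    also have "\<dots> = s" using PX dist len by (simp add: distinct_card)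
    finally show "size (singular_values ?V) = (\<Sum>m=1..l. num_clusters P m)"
      using size_singular_values[OF V sN'] by simp
    fix m assume m: "m \<in> {1..l}"
    have "\<exists>T. T \<subseteq> C \<and> card T = min m (card C)" for C :: "real set"
      using obtain_subset_with_card_n[of "min m (card C)" C] by (metis min.cobounded2)
    then obtain T :: "real set \<Rightarrow> real set" where T': "\<And>C. T C \<subseteq> C \<and> card (T C) = min m (card C)" by metis
    hence T: "\<And>C. C \<in> P \<Longrightarrow> T C \<subseteq> C" "\<And>C. C \<in> P \<Longrightarrow> card (T C) = min m (card C)" by auto
    define J where "J = {j. j < s \<and> xs ! j \<in> (\<Union>C\<in>P. T C)}"
    have imgJ: "nth xs ` J = (\<Union>C\<in>P. T C)"
    proof
      show "(\<Union>C\<in>P. T C) \<subseteq> nth xs ` J"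
      proof
        fix x assume x: "x \<in> (\<Union>C\<in>P. T C)"
        hence "x \<in> set xs" using T(1) PX by blast
        then obtain j where "j < s" "x = xs ! j" using len unfolding in_set_conv_nth by blast
        thus "x \<in> nth xs ` J" using x by (auto simp: J_def)
      qed
    qed (auto simp: J_def)
    have "(\<Sum>i=1..m. num_clusters P i) = (\<Sum>C\<in>P. card (T C))"
      unfolding sum_num_clusters[OF finP] by (simp add: T(2))
    also have "\<dots> = card (nth xs ` J)" by (simp only: card_Un[OF T(1)] imgJ)
    also have "\<dots> = card J" by (rule card_image) (rule inj_on_subset[OF inj], auto simp: J_def)
    also have "\<dots> \<le> size {#\<sigma> \<in># singular_values ?V. 1 / 2 * sqrt (real N) * (real N * \<Delta> / (32 * pi * exp 1)) ^ (m - 1) \<le> \<sigma>#}"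
    proof (rule card_le_singular_values_above[OF V sN'])
      fix c :: "nat \<Rightarrow> complex" assume c: "\<And>i. i \<notin> J \<Longrightarrow> c i = 0"
      define c' where "c' x = c (the_inv_into {..<s} (nth xs) x)" for x
      have c': "c' (xs ! j) = c j" if "j < s" for j
        using that by (simp add: c'_def the_inv_into_f_f[OF inj])
      have supp: "c' x = 0" if x: "x \<in> set xs" "x \<notin> (\<Union>C\<in>P. T C)" for x
      proof -
        obtain j where "j < s" "x = xs ! j" using x(1) len unfolding in_set_conv_nth by blast
        thus ?thesis using x(2) c[of j] c' by (simp add: J_def)
      qed
      have reindex: "(\<Sum>j<s. h (xs ! j)) = (\<Sum>C\<in>P. \<Sum>x\<in>T C. h x)"
        if h: "\<And>x. c' x = 0 \<Longrightarrow> h x = 0" for h :: "real \<Rightarrow> 'b::comm_monoid_add"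
      proof -
        have "(\<Sum>j<s. h (xs ! j)) = (\<Sum>x\<in>set xs. h x)"
          unfolding img[symmetric] by (simp add: sum.reindex[OF inj])
        also have "\<dots> = (\<Sum>x\<in>(\<Union>C\<in>P. T C). h x)"
          using T(1) PX supp h by (intro sum.mono_neutral_right) auto
        also have "\<dots> = (\<Sum>C\<in>P. \<Sum>x\<in>T C. h x)"
        proof (rule sum.UNION_disjoint[OF finP])
          show "\<forall>C\<in>P. finite (T C)" using T(1) finC by (meson finite_subset)
          show "\<forall>C\<in>P. \<forall>E\<in>P. C \<noteq> E \<longrightarrow> T C \<inter> T E = {}"
          proof (intro ballI impI)
            fix C E assume "C \<in> P" "E \<in> P" "C \<noteq> E"
            thus "T C \<inter> T E = {}" using disj T(1)[of C] T(1)[of E] unfolding disjoint_def by blast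
          qed
        qed
        finally show ?thesis .
      qed
      have "(\<Sum>j<s. (norm (c j))\<^sup>2) = (\<Sum>j<s. (norm (c' (xs ! j)))\<^sup>2)" by (simp add: c')
      also have "\<dots> = (\<Sum>C\<in>P. \<Sum>x\<in>T C. (norm (c' x))\<^sup>2)" by (rule reindex) simp
      finally have norm_c: "(\<Sum>j<s. (norm (c j))\<^sup>2) = (\<Sum>C\<in>P. \<Sum>x\<in>T C. (norm (c' x))\<^sup>2)" .
      have "(1 / 2 * sqrt (real N) * (real N * \<Delta> / (32 * pi * exp 1)) ^ (m - 1))\<^sup>2 * (\<Sum>j<s. (norm (c j))\<^sup>2)
          = real N * (real N * \<Delta> / (32 * pi * exp 1)) ^ (2 * (m - 1)) / 4 * (\<Sum>j<s. (norm (c j))\<^sup>2)"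
        unfolding power_even_eq power_mult_distrib by (simp add: power_one_over)
      also have "\<dots> \<le> real N * (real N * \<Delta> / (32 * pi * exp 1)) ^ (2 * (m - 1)) / 2 * (\<Sum>j<s. (norm (c j))\<^sup>2)"
        using D by (intro mult_right_mono divide_left_mono) (auto intro: sum_nonneg)
      also have "\<dots> \<le> (\<Sum>k\<le>N. (norm (\<Sum>C\<in>P. \<Sum>x\<in>T C. c' x * cis x ^ k))\<^sup>2)"
        unfolding norm_c using m T by (intro clusters_lower_bound[OF cfg part adm sN]) auto
      also have "\<dots> = (\<Sum>k\<le>N. (norm (\<Sum>j<s. ?V $$ (k, j) * c j))\<^sup>2)"
      proof (intro sum.cong refl)
        fix k assume "k \<in> {..N}"
        hence "(\<Sum>j<s. ?V $$ (k, j) * c j) = (\<Sum>j<s. c' (xs ! j) * cis (xs ! j) ^ k)"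
          by (intro sum.cong refl) (simp add: index_vandermonde len c' mult.commute)
        also have "\<dots> = (\<Sum>C\<in>P. \<Sum>x\<in>T C. c' x * cis x ^ k)" by (rule reindex) simp
        finally show "(norm (\<Sum>C\<in>P. \<Sum>x\<in>T C. c' x * cis x ^ k))\<^sup>2 = (norm (\<Sum>j<s. ?V $$ (k, j) * c j))\<^sup>2" by simp
      qed
      finally show "(1 / 2 * sqrt (real N) * (real N * \<Delta> / (32 * pi * exp 1)) ^ (m - 1))\<^sup>2 * (\<Sum>j<s. (norm (c j))\<^sup>2)
          \<le> (\<Sum>k<N + 1. (norm (\<Sum>j<s. ?V $$ (k, j) * c j))\<^sup>2)"
        by (simp only: lessThan_Suc_atMost Suc_eq_plus1[symmetric])
    qed (auto simp: J_def)
    finally show "(\<Sum>i=1..m. num_clusters P i)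
        \<le> size {#\<sigma> \<in># singular_values ?V. 1 / 2 * sqrt (real N) * (real N * \<Delta> / (32 * pi * exp 1)) ^ (m - 1) \<le> \<sigma>#}" .
  qed
qed auto

end
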